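(* The simple extension complexity of the spanning tree polytope $P_{\mathrm{spt}}(K_n)$ of the complete graph $K_n$ on $n$ nodes is in $\Omega\big(2^{\,n-o(n)}\big)$; that is, there exist a function $g$ with $g(n)/n\to 0$ as $n\to\infty$, a constant $c>0$ and $n_0$ such that $\operatorname{sxc}(P_{\mathrm{spt}}(K_n))\ge c\cdot 2^{\,n-g(n)}$ for all $n\ge n_0$.
   Context: The spanning tree polytope $P_{\mathrm{spt}}(K_n)$ is the convex hull in $\mathbb{R}^{E(K_n)}$ of the characteristic vectors of the edge sets of all spanning trees of $K_n$. An extension of a polytope $P$ is a polytope $Q$ together with a linear map $\pi$ (a projection) with $\pi(Q)=P$. The size of a polytope is its number of facets. A $d$-dimensional polytope is simple if every vertex is contained in exactly $d$ facets. The simple extension complexity $\operatorname{sxc}(P)$ is the smallest size of any simple polytope $Q$ that is an extension of $P$. *)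

theory Defs
  imports "HOL-Analysis.Analysis" "HOL-Analysis.Finite_Function_Topology"
begin

section \<open>Dimension, facets and simple polytopes in a real vector space\<close>

text \<open>
  The ambient dimension of an extension is not bounded in advance, so no single Euclidean
  type can host all of them.  The ambient spaces below are therefore spaces of finitely
  supported real functions.  There \<^const>\<open>polytope\<close>, \<^const>\<open>face_of\<close> and
  \<^const>\<open>extreme_point_of\<close> are available, but \<^const>\<open>aff_dim\<close> and \<^const>\<open>facet_of\<close>
  are not, as the library restricts them to Euclidean types.  The two definitions below
  agree with the library on Euclidean types, see \<open>int_affine_dim\<close> and \<open>is_facet_iff_facet_of\<close>.
\<close>

text \<open>The dimension of the linear space parallel to the affine hull; meaningful for nonempty
  sets with finite-dimensional affine hull.\<close>

definition affine_dim :: "'a::real_vector set \<Rightarrow> nat" where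
  "affine_dim S = dim {x - y | x y. x \<in> S \<and> y \<in> S}"

definition is_facet :: "'a::real_vector set \<Rightarrow> 'a set \<Rightarrow> bool" where
  "is_facet F Q \<longleftrightarrow> F face_of Q \<and> F \<noteq> {} \<and> affine_dim F + 1 = affine_dim Q"

definition num_facets :: "'a::real_vector set \<Rightarrow> nat" where
  "num_facets Q = card {F. is_facet F Q}"

definition simple_polytope :: "'a::real_vector set \<Rightarrow> bool" where
  "simple_polytope Q \<longleftrightarrow> polytope Q \<and>
     (\<forall>v. v extreme_point_of Q \<longrightarrow> card {F. is_facet F Q \<and> v \<in> F} = affine_dim Q)"

lemma int_affine_dim:
  fixes S :: "'a::euclidean_space set"
  assumes "S \<noteq> {}"
  shows "int (affine_dim S) = aff_dim S"
proof -
  obtain a where a: "a \<in> S" using assms by blast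
  let ?D = "{x - y | x y. x \<in> S \<and> y \<in> S}" and ?A = "(\<lambda>x. x - a) ` S"
  have "?D \<subseteq> span ?A"
  proof clarify
    fix x y assume "x \<in> S" "y \<in> S"
    then have "(x - a) - (y - a) \<in> span ?A"
      by (intro span_diff span_base imageI)
    then show "x - y \<in> span ?A" by simp
  qed
  then have "span ?D \<subseteq> span ?A"
    by (rule span_minimal) (rule subspace_span)
  moreover have "span ?A \<subseteq> span ?D"
    by (rule span_mono) (use a in blast)
  ultimately have "dim ?D = dim ?A"
    by (intro span_eq_dim subset_antisym)
  then show ?thesis
    using aff_dim_eq_dim_subtract[of a S] a by (simp only: affine_dim_def hull_inc)
qed

lemma is_facet_iff_facet_of:
  fixes Q :: "'a::euclidean_space set"
  shows "is_facet F Q \<longleftrightarrow> F facet_of Q"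
proof (cases "F face_of Q \<and> F \<noteq> {}")
  case True
  then have "Q \<noteq> {}" by (auto dest: face_of_imp_subset)
  with True show ?thesis
    using int_affine_dim[of F] int_affine_dim[of Q]
    by (auto simp: is_facet_def facet_of_def)
next
  case False
  then show ?thesis by (auto simp: is_facet_def facet_of_def)
qed

section \<open>Extensions\<close>

text \<open>Extending a linear map from a subspace to the whole space does not affect the image of
  \<open>Q\<close>, so it is no restriction to take \<open>\<pi>\<close> defined on the whole ambient space.\<close>

definition is_extension :: "'b::real_vector set \<Rightarrow> 'a::real_vector set \<Rightarrow> bool" where
  "is_extension Q P \<longleftrightarrow> polytope Q \<and> (\<exists>\<pi>. linear \<pi> \<and> \<pi> ` Q = P)"

text \<open>The space of finitely supported sequences is the union of all \<open>\<real>\<^sup>m\<close>, and each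
  polytope in it, being a convex hull of finitely many points, lies in one of these.  The set
  of sizes is nonempty for every polytope \<open>P\<close>, as every nonempty polytope is a linear image of
  a simplex.\<close>

definition sxc :: "'a::real_vector set \<Rightarrow> nat" where
  "sxc P = (LEAST s. \<exists>Q :: (nat \<Rightarrow>\<^sub>0 real) set.
     simple_polytope Q \<and> is_extension Q P \<and> num_facets Q = s)"

section \<open>The spanning tree polytope of the complete graph\<close>

definition complete_edges :: "nat \<Rightarrow> nat set set" where
  "complete_edges n = {e. e \<subseteq> {..<n} \<and> card e = 2}"

definition graph_connected :: "'v set \<Rightarrow> 'v set set \<Rightarrow> bool" where
  "graph_connected V T \<longleftrightarrow> (\<forall>u\<in>V. \<forall>v\<in>V. (u, v) \<in> {(a, b). {a, b} \<in> T}\<^sup>*)"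

text \<open>A cycle is given by its cyclic list of vertices.\<close>

definition graph_cycle :: "'v set set \<Rightarrow> 'v list \<Rightarrow> bool" where
  "graph_cycle T vs \<longleftrightarrow> 3 \<le> length vs \<and> distinct vs \<and>
     (\<forall>i<length vs. {vs ! i, vs ! (Suc i mod length vs)} \<in> T)"

definition spanning_tree :: "nat \<Rightarrow> nat set set \<Rightarrow> bool" where
  "spanning_tree n T \<longleftrightarrow> T \<subseteq> complete_edges n \<and> graph_connected {..<n} T \<and>
     (\<nexists>vs. graph_cycle T vs)"

definition char_vec :: "'e set \<Rightarrow> ('e \<Rightarrow>\<^sub>0 real)" where
  "char_vec T = (\<Sum>e\<in>T. Poly_Mapping.single e 1)"

text \<open>\<open>\<real>\<close> to the power \<open>E(K\<^sub>n)\<close> is regarded as the space of functions supported on \<open>E(K\<^sub>n)\<close>.\<close>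

definition spt_polytope :: "nat \<Rightarrow> (nat set \<Rightarrow>\<^sub>0 real) set" where
  "spt_polytope n = convex hull (char_vec ` {T. spanning_tree n T})"

end

theory Submission
  imports Defs
begin

text \<open>
  Let \<open>\<pi>\<close> be a linear map of a simple polytope \<open>Q\<close> onto \<open>P\<close>.  Say that a facet of \<open>Q\<close> avoids a
  point \<open>p\<close> of \<open>P\<close> if it does not contain the whole fibre of \<open>Q\<close> over \<open>p\<close>.  Near a vertex, a simple
  polytope is a simplicial cone: its faces through the vertex correspond to sets of facets, and
  intersecting faces amounts to uniting these sets.  Hence a facet that contains a nonempty
  intersection of two faces contains one of the two (\<open>facet_prime\<close>).  Apply this to the preimages of
  two faces \<open>A\<close> and \<open>B\<close> of \<open>P\<close> with \<open>A \<inter> B = {p}\<close>: a facet that avoids a point of \<open>A\<close> and a point of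
  \<open>B\<close> also avoids \<open>p\<close>.  So the avoided set of a facet is closed under the operation in \<open>face_closed\<close>.
  On the other hand, whenever a vertex \<open>w\<close> of \<open>P\<close> differs from a point \<open>v\<close>, some facet of \<open>Q\<close> contains
  the fibre of \<open>w\<close> and avoids \<open>v\<close>.

  Spanning tree polytopes have few closed sets.  If a closed set contains the trees \<open>u\<close> and \<open>w\<close>, it
  contains every tree \<open>v\<close> that is the only one between \<open>v \<inter> (u \<union> w)\<close> and \<open>v \<union> (u \<inter> w)\<close>
  (\<open>face_closed_between\<close>).  Take the \<open>2 ^ (n - 2)\<close> double stars with hubs \<open>0\<close> and \<open>1\<close>, given by the set
  \<open>S\<close> of leaves attached to \<open>1\<close>.  A closed set that contains the double star of \<open>S\<close> and another one
  also contains the tree in which the edge \<open>{0, 1}\<close> of the first is replaced by the path \<open>0, 2, 1\<close>.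
  A facet that avoids the double star of \<open>S\<close> but not this second tree therefore avoids no other
  double star, so different sets \<open>S\<close> need different facets, and the size is at least \<open>2 ^ (n - 2)\<close>.

  The polytopes live in arbitrary real vector spaces, and the local structure of \<open>Q\<close> is derived
  from its dual cone: every linear functional that attains its maximum over \<open>Q\<close> at a point
  is, up to constants on \<open>Q\<close>, a nonnegative combination of functionals defining facets
  (\<open>nonpos_on_conic_combination\<close>).  Finally, since \<^const>\<open>sxc\<close> is a least number, a lower bound for all
  simple extensions transfers to it only because one exists: a simplex over the vertices of \<open>P\<close>.
\<close>

section \<open>Linear functionals on a real vector space\<close>

lemma separating_functional:
  fixes a :: "'a::real_vector"
  assumes "a \<notin> span S"
  obtains f :: "'a \<Rightarrow> real" where "linear f" "\<And>u. u \<in> S \<Longrightarrow> f u = 0" "f a = 1"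
proof -
  obtain B where B: "B \<subseteq> S" "independent B" "S \<subseteq> span B"
    by (rule basis_exists)
  have "span B \<subseteq> span S" using B by (simp add: span_mono)
  then have a: "a \<notin> span B" using assms by blast
  then have "independent (insert a B)"
    using B(2) by (rule independent_insertI)
  then obtain f :: "'a \<Rightarrow> real"
    where f: "linear f" "\<forall>u\<in>insert a B. f u = (if u = a then 1 else 0)"
    using linear_independent_extend[of "insert a B" "\<lambda>u. if u = a then 1 else 0 :: real"] by blast
  have "a \<notin> B" using a span_base by blast
  then have "f b = 0" if "b \<in> B" for b using f(2) that by auto
  then have "f u = 0" if "u \<in> span B" for u
    using linear_eq_0_on_span[OF f(1)] that by blast
  with B(3) f show thesis by (intro that[of f]) auto
qed

lemma dim_insert_finite:
  fixes a :: "'a::real_vector"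
  assumes "finite S" "a \<notin> span S"
  shows "dim (insert a S) = dim S + 1"
proof -
  obtain B where B: "B \<subseteq> S" "independent B" "S \<subseteq> span B" "card B = dim S"
    by (rule basis_exists)
  have sub: "span B \<subseteq> span S" using B by (simp add: span_mono)
  then have a: "a \<notin> span B" using assms(2) by blast
  have fin: "finite B" using B(1) assms(1) finite_subset by blast
  have "insert a S \<subseteq> span (insert a B)"
    using B(3) span_mono[of B "insert a B"] span_base[of a "insert a B"] by auto
  moreover have "independent (insert a B)"
    using B(2) a by (simp add: independent_insertI)
  ultimately have "dim (insert a S) = card (insert a B)"
    using B(1) by (intro dim_unique[of "insert a B"]) auto
  also have "\<dots> = dim S + 1"
    using fin a span_base B(4) by (subst card_insert_disjoint) auto
  finally show ?thesis .
qed

lemma lookup_scaleR: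
  fixes x :: "'k \<Rightarrow>\<^sub>0 'a::real_vector"
  shows "Poly_Mapping.lookup (c *\<^sub>R x) i = c *\<^sub>R Poly_Mapping.lookup x i"
proof -
  have "finite {i. c *\<^sub>R Poly_Mapping.lookup x i \<noteq> 0}"
    by (rule finite_subset[OF _ finite_keys[of x]]) (auto simp: in_keys_iff)
  then show ?thesis by (simp add: scaleR_poly_mapping_def Abs_poly_mapping_inverse)
qed

text \<open>Evaluating the functionals is a linear map into a space spanned by \<open>card K\<close> vectors, which
  cannot be injective on the larger space \<open>span D\<close>.\<close>

lemma common_kernel:
  fixes m :: "'k \<Rightarrow> 'a::real_vector \<Rightarrow> real"
  assumes "finite D" "finite K" "card K < dim D" and lin: "\<And>k. k \<in> K \<Longrightarrow> linear (m k)"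
  obtains u where "u \<in> span D" "u \<noteq> 0" "\<And>k. k \<in> K \<Longrightarrow> m k u = 0"
proof -
  obtain B where B: "B \<subseteq> D" "independent B" "D \<subseteq> span B" "card B = dim D"
    by (rule basis_exists)
  have spB: "span B \<subseteq> span D" using B by (simp add: span_mono)
  define e :: "'k \<Rightarrow> 'k \<Rightarrow>\<^sub>0 real" where "e k = Poly_Mapping.single k 1" for k
  define f where "f u = (\<Sum>k\<in>K. m k u *\<^sub>R e k)" for u
  have linf: "linear f"
    unfolding f_def
    by (intro linear_compose_sum ballI linearI)
      (use lin in \<open>auto simp: linear_add linear_scale scaleR_left_distrib\<close>)
  have lookup_scale: "Poly_Mapping.lookup (c *\<^sub>R e k) j = (if j = k then c else 0)" for c k j
    by (simp add: e_def lookup_scaleR lookup_single when_def)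
  have lookup_f: "Poly_Mapping.lookup (f u) j = m j u" if "j \<in> K" for u j
    using that assms(2) by (simp add: f_def lookup_sum lookup_scale)
  have "\<not> inj_on f (span B)"
  proof
    assume inj: "inj_on f (span B)"
    then have "independent (f ` B)"
      by (rule linear_independent_injective_image[OF linf B(2)])
    moreover have "f ` B \<subseteq> span (e ` K)"
      unfolding f_def by (intro image_subsetI span_sum span_scale span_base imageI)
    ultimately have "card (f ` B) \<le> card (e ` K)"
      using independent_span_bound[of "e ` K" "f ` B"] assms(2) by auto
    also have "\<dots> \<le> card K" using assms(2) by (rule card_image_le)
    finally have "card (f ` B) \<le> card K" .
    moreover have "card (f ` B) = card B"
      using inj by (intro card_image) (meson inj_on_subset span_superset)
    ultimately show False using assms(3) B(4) by simp
  qed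
  then obtain u v where uv: "u \<in> span B" "v \<in> span B" "f u = f v" "u \<noteq> v"
    by (auto simp: inj_on_def)
  have "m k (u - v) = 0" if "k \<in> K" for k
    using lookup_f[OF that, of u] lookup_f[OF that, of v] uv(3) lin[OF that]
    by (simp add: linear_diff)
  with uv spB show thesis
    by (intro that[of "u - v"]) (auto intro: span_diff)
qed

section \<open>The dual cone of a finite set\<close>

text \<open>Below, \<open>D\<close> consists of the differences \<open>v - x\<close> of the vertices \<open>v\<close> of a polytope with one of its
  points \<open>x\<close>.  The functionals that are \<open>nonpos_on D\<close> are those attaining their maximum over the
  polytope at \<open>x\<close>, and \<open>tight\<close> selects the vertices on the face where the maximum is attained.  The
  facets through \<open>x\<close> are represented by the tight sets of codimension one.\<close>

definition nonpos_on :: "'a::real_vector set \<Rightarrow> ('a \<Rightarrow> real) \<Rightarrow> bool" where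
  "nonpos_on D l \<longleftrightarrow> linear l \<and> (\<forall>u\<in>D. l u \<le> 0)"

definition tight :: "'a set \<Rightarrow> ('a \<Rightarrow> real) \<Rightarrow> 'a set" where
  "tight D l = {u \<in> D. l u = 0}"

definition facet_functional :: "'a::real_vector set \<Rightarrow> ('a \<Rightarrow> real) \<Rightarrow> bool" where
  "facet_functional D l \<longleftrightarrow> nonpos_on D l \<and> dim (tight D l) + 1 = dim D"

definition facet_traces :: "'a::real_vector set \<Rightarrow> 'a set set" where
  "facet_traces D = {tight D l | l. facet_functional D l}"

text \<open>A facet determines its functional on \<open>span D\<close> only up to a positive factor; the choice of one
  functional for each facet makes the facet functionals a finite family.\<close>

definition trace_functional :: "'a::real_vector set \<Rightarrow> 'a set \<Rightarrow> 'a \<Rightarrow> real" where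
  "trace_functional D T = (SOME l. facet_functional D l \<and> tight D l = T)"

lemma trace_functional:
  assumes "T \<in> facet_traces D"
  shows "facet_functional D (trace_functional D T)" "tight D (trace_functional D T) = T"
proof -
  have "\<exists>l. facet_functional D l \<and> tight D l = T"
    using assms by (auto simp: facet_traces_def)
  from someI_ex[OF this]
  show "facet_functional D (trace_functional D T)" "tight D (trace_functional D T) = T"
    by (simp_all add: trace_functional_def)
qed

lemma trace_functional_linear: "T \<in> facet_traces D \<Longrightarrow> linear (trace_functional D T)"
  using trace_functional(1) by (auto simp: facet_functional_def nonpos_on_def)

lemma trace_functional_le: "T \<in> facet_traces D \<Longrightarrow> u \<in> D \<Longrightarrow> trace_functional D T u \<le> 0"
  using trace_functional(1) by (auto simp: facet_functional_def nonpos_on_def)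

lemma trace_functional_eq_0: "T \<in> facet_traces D \<Longrightarrow> u \<in> D \<Longrightarrow> trace_functional D T u = 0 \<longleftrightarrow> u \<in> T"
  using trace_functional(2) by (force simp: tight_def)

lemma finite_facet_traces: "finite D \<Longrightarrow> finite (facet_traces D)"
  by (rule finite_subset[of _ "Pow D"]) (auto simp: facet_traces_def tight_def)

text \<open>Starting at \<open>l\<close>, move in direction \<open>m\<close> until the first further inequality becomes an equality.\<close>

lemma nonpos_on_push:
  assumes "finite D" and l: "nonpos_on D l" and m: "linear m" "\<And>u. u \<in> tight D l \<Longrightarrow> m u = 0"
    and ex: "\<exists>u\<in>D. m u > 0"
  obtains s where "s > 0" "nonpos_on D (\<lambda>u. l u + s * m u)"
    "tight D l \<subset> tight D (\<lambda>u. l u + s * m u)"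
proof -
  define U where "U = {u \<in> D. m u > 0}"
  define s where "s = Min ((\<lambda>u. - l u / m u) ` U)"
  have U: "finite U" "U \<noteq> {}" using assms(1) ex by (auto simp: U_def)
  have neg: "l u < 0" if "u \<in> U" for u
    using that l m(2)[of u] by (force simp: U_def nonpos_on_def tight_def)
  have smin: "s \<le> - l u / m u" if "u \<in> U" for u
    unfolding s_def using U that by (intro Min_le) auto
  have "s \<in> (\<lambda>u. - l u / m u) ` U"
    unfolding s_def using U by (intro Min_in) auto
  then obtain u0 where u0: "u0 \<in> U" "s = - l u0 / m u0" by blast
  have s: "s > 0"
    unfolding u0(2) using u0(1) neg[OF u0(1)] by (intro divide_pos_pos) (auto simp: U_def)
  have "l u + s * m u \<le> 0" if "u \<in> D" for u
  proof (cases "u \<in> U")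
    case True
    then have "s * m u \<le> - l u"
      using smin[OF True] by (simp add: U_def field_simps)
    then show ?thesis by simp
  next
    case False
    then have "s * m u \<le> 0" using that s by (simp add: U_def mult_nonneg_nonpos)
    moreover have "l u \<le> 0" using l that by (simp add: nonpos_on_def)
    ultimately show ?thesis by simp
  qed
  moreover have "linear (\<lambda>u. l u + s * m u)"
    using l m(1) linear_compose_add[of l "\<lambda>u. s *\<^sub>R m u"] linear_compose_scale_right[of m s]
    by (simp add: nonpos_on_def)
  ultimately have np: "nonpos_on D (\<lambda>u. l u + s * m u)" by (simp add: nonpos_on_def)
  have "u0 \<in> tight D (\<lambda>u. l u + s * m u)" "u0 \<notin> tight D l"
    using u0 neg[OF u0(1)] by (auto simp: tight_def U_def)
  moreover have "tight D l \<subseteq> tight D (\<lambda>u. l u + s * m u)"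
    using m(2) by (auto simp: tight_def)
  ultimately show thesis using that[OF s np] by blast
qed

text \<open>The extreme rays of the dual cone are the facet functionals, and they generate it.  The
  induction is on the number of elements that are not tight for \<open>l\<close>.  If some direction \<open>m\<close> that is nonzero
  on \<open>D\<close> keeps the tight elements tight and does not change the value at the sum \<open>z\<close> of \<open>D\<close>, then \<open>l\<close> can be moved
  along \<open>m\<close> both ways until new elements become tight, and \<open>l\<close> lies between the two ends.  If \<open>l\<close> is
  nonzero and there is no such direction, the tight elements and \<open>z\<close> span everything; then \<open>l\<close> is itself a facet functional.\<close>

lemma nonpos_on_conic_combination:
  assumes "finite D" "nonpos_on D l"
  shows "\<exists>c. (\<forall>T\<in>facet_traces D. c T \<ge> (0::real)) \<and>
    (\<forall>u\<in>D. l u = (\<Sum>T\<in>facet_traces D. c T * trace_functional D T u))"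
  using assms(2)
proof (induction "card (D - tight D l)" arbitrary: l rule: less_induct)
  case less
  note l = less.prems
  have linl: "linear l" and le: "\<And>u. u \<in> D \<Longrightarrow> l u \<le> 0"
    using l by (auto simp: nonpos_on_def)
  define z where "z = \<Sum>D"
  have sumD: "m z = (\<Sum>u\<in>D. m u)" if "linear m" for m :: "'a \<Rightarrow> real"
    using that by (simp add: z_def linear_sum)
  consider "\<forall>u\<in>D. l u = 0"
    | m where "linear m" "\<forall>u\<in>tight D l. m u = 0" "m z = 0" "\<exists>u\<in>D. m u \<noteq> (0::real)"
    | "\<exists>u\<in>D. l u \<noteq> 0" "\<And>m :: 'a \<Rightarrow> real. linear m \<Longrightarrow> (\<forall>u\<in>tight D l. m u = 0) \<Longrightarrow> m z = 0 \<Longrightarrow> \<forall>u\<in>D. m u = 0"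
    by blast
  then show ?case
  proof cases
    case 1
    then show ?thesis by (intro exI[of _ "\<lambda>_. 0"]) simp
  next
    case 2
    have bigger: "\<exists>c. (\<forall>T\<in>facet_traces D. c T \<ge> (0::real)) \<and>
        (\<forall>u\<in>D. k u = (\<Sum>T\<in>facet_traces D. c T * trace_functional D T u))"
      if "nonpos_on D k" "tight D l \<subset> tight D k" for k
    proof (rule less.hyps[OF _ that(1)])
      show "card (D - tight D k) < card (D - tight D l)"
        using that(2) assms(1) by (intro psubset_card_mono) (auto simp: tight_def)
    qed
    \<comment> \<open>the values of m on D sum to m z = 0, so both signs occur and neither move is unbounded\<close>
    have "\<exists>u\<in>D. m u > 0"
    proof (rule ccontr)
      assume "\<not> ?thesis"
      then have "\<forall>u\<in>D. - m u \<ge> 0" by force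
      moreover have "(\<Sum>u\<in>D. - m u) = 0" using sumD[OF 2(1)] 2(3) by (simp add: sum_negf)
      ultimately have "\<forall>u\<in>D. - m u = 0" using assms(1) by (simp add: sum_nonneg_eq_0_iff)
      with 2(4) show False by simp
    qed
    then obtain s where s: "s > 0" "nonpos_on D (\<lambda>u. l u + s * m u)"
        "tight D l \<subset> tight D (\<lambda>u. l u + s * m u)"
      using nonpos_on_push[OF assms(1) l 2(1)] 2(2) by blast
    have "\<exists>u\<in>D. - m u > 0"
    proof (rule ccontr)
      assume "\<not> ?thesis"
      then have "\<forall>u\<in>D. m u \<ge> 0" by force
      moreover have "(\<Sum>u\<in>D. m u) = 0" using sumD[OF 2(1)] 2(3) by simp
      ultimately have "\<forall>u\<in>D. m u = 0" using assms(1) by (simp add: sum_nonneg_eq_0_iff)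
      with 2(4) show False by simp
    qed
    moreover have "linear (\<lambda>u. - m u)" using 2(1) by (rule linear_compose_neg)
    ultimately obtain t where t: "t > 0" "nonpos_on D (\<lambda>u. l u + t * - m u)"
        "tight D l \<subset> tight D (\<lambda>u. l u + t * - m u)"
      using nonpos_on_push[OF assms(1) l, of "\<lambda>u. - m u"] 2(2) by auto
    obtain c where c: "\<forall>T\<in>facet_traces D. c T \<ge> 0"
        "\<forall>u\<in>D. l u + s * m u = (\<Sum>T\<in>facet_traces D. c T * trace_functional D T u)"
      using bigger[OF s(2,3)] by blast
    obtain d where d: "\<forall>T\<in>facet_traces D. d T \<ge> 0"
        "\<forall>u\<in>D. l u + t * - m u = (\<Sum>T\<in>facet_traces D. d T * trace_functional D T u)"
      using bigger[OF t(2,3)] by blast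
    have "l u = (\<Sum>T\<in>facet_traces D. (t * c T + s * d T) / (s + t) * trace_functional D T u)"
      if "u \<in> D" for u
    proof -
      have "(\<Sum>T\<in>facet_traces D. (t * c T + s * d T) / (s + t) * trace_functional D T u)
         = t / (s + t) * (\<Sum>T\<in>facet_traces D. c T * trace_functional D T u)
           + s / (s + t) * (\<Sum>T\<in>facet_traces D. d T * trace_functional D T u)"
        by (simp add: sum_distrib_left sum.distrib[symmetric] add_divide_distrib algebra_simps)
      also have "\<dots> = t / (s + t) * (l u + s * m u) + s / (s + t) * (l u + t * - m u)"
        using c(2) d(2) that by simp
      also have "\<dots> = (s + t) / (s + t) * l u"
        unfolding times_divide_eq_left add_divide_distrib[symmetric]
        by (rule arg_cong[of _ _ "\<lambda>r. r / (s + t)"]) (simp add: algebra_simps)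
      also have "\<dots> = l u" using s(1) t(1) by simp
      finally show ?thesis by simp
    qed
    then show ?thesis
      using c(1) d(1) s(1) t(1)
      by (intro exI[of _ "\<lambda>T. (t * c T + s * d T) / (s + t)"]) simp
  next
    case 3
    have lz: "l z < 0"
    proof -
      have "(\<Sum>u\<in>D. - l u) \<noteq> 0"
        using 3(1) le assms(1) by (subst sum_nonneg_eq_0_iff) auto
      moreover have "(\<Sum>u\<in>D. - l u) \<ge> 0" using le by (simp add: sum_nonneg)
      ultimately show ?thesis using sumD[OF linl] by (simp add: sum_negf)
    qed
    have fin: "finite (tight D l)" using assms(1) by (simp add: tight_def)
    have "u \<in> span (insert z (tight D l))" if u: "u \<in> D" for u
    proof (rule ccontr)
      assume "u \<notin> span (insert z (tight D l))"
      then obtain f :: "'a \<Rightarrow> real" where "linear f" "\<And>v. v \<in> insert z (tight D l) \<Longrightarrow> f v = 0" "f u = 1"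
        by (rule separating_functional) blast
      with 3(2)[of f] u show False by auto
    qed
    then have "D \<subseteq> span (insert z (tight D l))" by blast
    moreover have "insert z (tight D l) \<subseteq> span D"
      by (auto simp: z_def tight_def intro: span_sum span_base)
    ultimately have "dim D = dim (insert z (tight D l))"
      by (intro span_eq_dim subset_antisym span_minimal) (auto simp: subspace_span)
    also have "z \<notin> span (tight D l)"
      using lz linear_eq_0_on_span[OF linl, of "tight D l" z] by (auto simp: tight_def)
    then have "dim (insert z (tight D l)) = dim (tight D l) + 1"
      using fin by (rule dim_insert_finite[rotated])
    finally have "facet_functional D l" using l by (simp add: facet_functional_def)
    then have T: "tight D l \<in> facet_traces D" by (auto simp: facet_traces_def)
    define m where "m = trace_functional D (tight D l)"
    have m: "linear m" "\<And>u. u \<in> D \<Longrightarrow> m u \<le> 0"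
      "\<And>u. u \<in> D \<Longrightarrow> m u = 0 \<longleftrightarrow> u \<in> tight D l"
      unfolding m_def using T trace_functional_linear trace_functional_le trace_functional_eq_0
      by blast+
    have mz: "m z < 0"
    proof -
      have "(\<Sum>u\<in>D. - m u) \<noteq> 0"
        using 3(1) m assms(1) by (subst sum_nonneg_eq_0_iff) (auto simp: tight_def)
      moreover have "(\<Sum>u\<in>D. - m u) \<ge> 0" using m by (simp add: sum_nonneg)
      ultimately show ?thesis using sumD[OF m(1)] by (simp add: sum_negf)
    qed
    \<comment> \<open>l and m vanish on the tight elements and are therefore proportional, with the ratio read off at z\<close>
    define a where "a = l z / m z"
    have "linear (\<lambda>u. l u - a * m u)"
      using linl m(1) linear_compose_sub[of l "\<lambda>u. a *\<^sub>R m u"] linear_compose_scale_right[of m a]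
      by simp
    moreover have "\<forall>u\<in>tight D l. l u - a * m u = 0" using m(3) by (auto simp: tight_def)
    moreover have "l z - a * m z = 0" using mz by (simp add: a_def)
    ultimately have "\<forall>u\<in>D. l u - a * m u = 0" by (rule 3(2))
    moreover have "(\<Sum>T\<in>facet_traces D. (if T = tight D l then a else 0) * trace_functional D T u) = a * m u" for u
      using T finite_facet_traces[OF assms(1)] 
      by (simp add: m_def if_distrib[of "\<lambda>x. x * _"] cong: if_cong)
    moreover have "a \<ge> 0" using lz mz by (simp add: a_def divide_nonpos_neg)
    ultimately show ?thesis
      by (intro exI[of _ "\<lambda>T. if T = tight D l then a else 0"]) auto
  qed
qed

lemma nonpos_on_conic_combination_span:
  assumes "finite D" "nonpos_on D l"
  obtains c where "\<And>T. T \<in> facet_traces D \<Longrightarrow> c T \<ge> (0::real)"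
    "\<And>u. u \<in> span D \<Longrightarrow> l u = (\<Sum>T\<in>facet_traces D. c T * trace_functional D T u)"
proof -
  obtain c where c: "\<forall>T\<in>facet_traces D. c T \<ge> (0::real)"
    "\<forall>u\<in>D. l u = (\<Sum>T\<in>facet_traces D. c T * trace_functional D T u)"
    using nonpos_on_conic_combination[OF assms] by blast
  have "linear (\<lambda>u. \<Sum>T\<in>facet_traces D. c T *\<^sub>R trace_functional D T u)"
    by (intro linear_compose_sum ballI linear_compose_scale_right trace_functional_linear)
  then have "l u = (\<Sum>T\<in>facet_traces D. c T * trace_functional D T u)" if "u \<in> span D" for u
    using linear_eq_on_span[of l "\<lambda>u. \<Sum>T\<in>facet_traces D. c T *\<^sub>R trace_functional D T u" D u]
      c(2) that assms(2) by (simp add: nonpos_on_def)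
  with c(1) show thesis by (intro that[of c]) auto
qed

text \<open>A large multiple of \<open>l\<close> outweighs \<open>f\<close> wherever \<open>l\<close> is negative, so \<open>f\<close> matters only on the
  elements that are tight for \<open>l\<close>.\<close>

lemma nonpos_on_dominate:
  assumes "finite D" "nonpos_on D l" "linear f" "\<And>u. u \<in> D \<Longrightarrow> l u = 0 \<Longrightarrow> f u \<le> 0"
  obtains K where "nonpos_on D (\<lambda>u. K * l u + f u)"
proof -
  define K where "K = (\<Sum>u\<in>D. \<bar>f u / l u\<bar>)"
  have "K * l u + f u \<le> 0" if u: "u \<in> D" for u
  proof (cases "l u = 0")
    case True
    then show ?thesis using assms(4) u by simp
  next
    case False
    then have neg: "l u < 0" using assms(2) u by (force simp: nonpos_on_def)
    have "\<bar>f u / l u\<bar> \<le> K"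
      unfolding K_def by (rule member_le_sum) (use u assms(1) in auto)
    then have "K * l u \<le> \<bar>f u / l u\<bar> * l u" using neg by (intro mult_right_mono_neg) auto
    also have "\<dots> = - \<bar>f u\<bar>" using neg by (simp add: abs_divide)
    finally show ?thesis by simp
  qed
  moreover have "linear (\<lambda>u. K * l u + f u)"
    using assms(2,3) linear_compose_add[of "\<lambda>u. K *\<^sub>R l u" f] linear_compose_scale_right[of l K]
    by (simp add: nonpos_on_def)
  ultimately show thesis by (intro that[of K]) (simp add: nonpos_on_def)
qed

text \<open>If \<open>x\<close> is a vertex, exposed by \<open>l0\<close>, then every functional becomes \<open>nonpos_on D\<close> after adding a
  large multiple of \<open>l0\<close>.  So the facet functionals span the dual of \<open>span D\<close>, and if there are at most
  \<open>dim D\<close> of them they form a basis.  The vector \<open>t\<close> belongs to the dual basis: it points along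
  the edge at \<open>x\<close> that leaves the facet \<open>T\<close> and stays in all the others.\<close>

lemma facet_normals_independent:
  assumes "finite D" and l0: "nonpos_on D l0" "\<And>u. u \<in> D \<Longrightarrow> u \<noteq> 0 \<Longrightarrow> l0 u < 0"
    and card: "card (facet_traces D) \<le> dim D" and T: "T \<in> facet_traces D"
  obtains t where "t \<in> span D" "trace_functional D T t = - 1"
    "\<And>T'. T' \<in> facet_traces D \<Longrightarrow> T' \<noteq> T \<Longrightarrow> trace_functional D T' t = 0"
proof -
  note fin = finite_facet_traces[OF assms(1)]
  have "card (facet_traces D - {T}) < dim D"
    using card_Diff1_less[OF fin T] card by (rule less_le_trans)
  then obtain u where u: "u \<in> span D" "u \<noteq> 0"
    "\<And>T'. T' \<in> facet_traces D - {T} \<Longrightarrow> trace_functional D T' u = 0"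
    using common_kernel[of D "facet_traces D - {T}" "trace_functional D"] assms(1) fin
      trace_functional_linear by (metis DiffD1 finite_Diff)
  have "trace_functional D T u \<noteq> 0"
  proof
    assume "trace_functional D T u = 0"
    then have zero: "trace_functional D T' u = 0" if "T' \<in> facet_traces D" for T'
      using u(3)[of T'] that by (cases "T' = T") auto
    have vanish: "l u = 0" if l: "nonpos_on D l" for l
    proof -
      obtain c where "\<And>v. v \<in> span D \<Longrightarrow> l v = (\<Sum>T\<in>facet_traces D. c T * trace_functional D T v)"
        using nonpos_on_conic_combination_span[OF assms(1) l] by blast
      with u(1) zero show ?thesis by simp
    qed
    have "u \<notin> span {}" using u(2) by simp
    then obtain f :: "'a \<Rightarrow> real" where f: "linear f" "f u = 1"
      by (rule separating_functional) blast
    obtain K where "nonpos_on D (\<lambda>v. K * l0 v + f v)"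
      by (rule nonpos_on_dominate[OF assms(1) l0(1) f(1)])
        (use l0(2) linear_0[OF f(1)] in force)
    from vanish[OF this] vanish[OF l0(1)] f(2) show False by simp
  qed
  then have "(- 1 / trace_functional D T u) * trace_functional D T u = - 1" by simp
  then obtain r where "r * trace_functional D T u = - 1" by blast
  then have "trace_functional D T (r *\<^sub>R u) = - 1"
    by (simp add: linear_scale[OF trace_functional_linear[OF T]])
  moreover have "trace_functional D T' (r *\<^sub>R u) = 0"
    if "T' \<in> facet_traces D" "T' \<noteq> T" for T'
    using u(3)[of T'] that by (simp add: linear_scale[OF trace_functional_linear[OF that(1)]])
  ultimately show thesis
    using u(1) by (intro that[of "r *\<^sub>R u"]) (auto intro: span_scale)
qed

text \<open>If \<open>g\<close> vanishes at an element of \<open>D\<close> outside the facet \<open>T\<close>, then the functional of \<open>T\<close> has coefficient zero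
  in the conic combination for \<open>g\<close>, that is, \<open>g t = 0\<close> for the edge direction \<open>t\<close> leaving \<open>T\<close>.
  Suppose this holds for \<open>g\<close> and for \<open>h\<close>, but \<open>T\<close> contains all that is tight for both.  Subtracting the
  functional of \<open>T\<close> from a large multiple of \<open>g + h\<close> stays in the dual cone, yet gives the value
  \<open>1\<close> at \<open>t\<close>, where the cone is nonpositive.\<close>

lemma facet_trace_prime:
  assumes "finite D" and l0: "nonpos_on D l0" "\<And>u. u \<in> D \<Longrightarrow> u \<noteq> 0 \<Longrightarrow> l0 u < 0"
    and card: "card (facet_traces D) \<le> dim D" and T: "T \<in> facet_traces D"
    and g: "nonpos_on D g" and h: "nonpos_on D h"
    and sub: "tight D g \<inter> tight D h \<subseteq> T"
  shows "tight D g \<subseteq> T \<or> tight D h \<subseteq> T"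
proof (rule ccontr)
  assume neither: "\<not> ?thesis"
  note fin = finite_facet_traces[OF assms(1)]
  obtain t where t: "t \<in> span D" "trace_functional D T t = - 1"
    "\<And>T'. T' \<in> facet_traces D \<Longrightarrow> T' \<noteq> T \<Longrightarrow> trace_functional D T' t = 0"
    using facet_normals_independent[OF assms(1) l0 card T] by blast
  have at_t: "(\<Sum>T'\<in>facet_traces D. c T' * trace_functional D T' t) = - c T" for c
  proof -
    have "(\<Sum>T'\<in>facet_traces D. c T' * trace_functional D T' t)
        = (\<Sum>T'\<in>facet_traces D. if T' = T then - c T else 0)"
      using t by (intro sum.cong) auto
    then show ?thesis using T fin by simp
  qed
  have zero_at_t: "l t = 0" if l: "nonpos_on D l" and ntl: "\<not> tight D l \<subseteq> T" for l
  proof -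
    obtain c where c: "\<And>T. T \<in> facet_traces D \<Longrightarrow> c T \<ge> 0"
      "\<And>u. u \<in> span D \<Longrightarrow> l u = (\<Sum>T\<in>facet_traces D. c T * trace_functional D T u)"
      using nonpos_on_conic_combination_span[OF assms(1) l] by blast
    obtain y where y: "y \<in> D" "l y = 0" "y \<notin> T" using ntl by (auto simp: tight_def)
    have "(\<Sum>T\<in>facet_traces D. - (c T * trace_functional D T y)) = 0"
      using c(2)[of y] y by (simp add: span_base sum_negf)
    then have "c T * trace_functional D T y = 0"
      using T fin mult_nonneg_nonpos[OF c(1) trace_functional_le[OF _ y(1)]]
      by (subst (asm) sum_nonneg_eq_0_iff) auto
    then have "c T = 0" using y trace_functional_eq_0[OF T] by auto
    then show ?thesis using c(2)[OF t(1)] at_t by simp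
  qed
  have gh: "nonpos_on D (\<lambda>u. g u + h u)"
    using g h linear_compose_add by (fastforce simp: nonpos_on_def)
  have "u \<in> T" if "u \<in> D" "g u + h u = 0" for u
    using that g h sub by (force simp: nonpos_on_def tight_def)
  then have "- trace_functional D T u \<le> 0" if "u \<in> D" "g u + h u = 0" for u
    using that trace_functional_eq_0[OF T that(1)] by simp
  then obtain K where K: "nonpos_on D (\<lambda>u. K * (g u + h u) + - trace_functional D T u)"
    using nonpos_on_dominate[OF assms(1) gh linear_compose_neg[OF trace_functional_linear[OF T]]]
    by blast
  obtain a where a: "\<And>T. T \<in> facet_traces D \<Longrightarrow> a T \<ge> 0"
    "\<And>u. u \<in> span D \<Longrightarrow> K * (g u + h u) + - trace_functional D T u
       = (\<Sum>T\<in>facet_traces D. a T * trace_functional D T u)"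
    using nonpos_on_conic_combination_span[OF assms(1) K] by blast
  have "K * (g t + h t) + - trace_functional D T t = - a T"
    using a(2)[OF t(1)] at_t by simp
  moreover have "g t = 0" "h t = 0"
    using zero_at_t[OF g] zero_at_t[OF h] neither by blast+
  ultimately have "1 = - a T" using t(2) by simp
  with a(1)[OF T] show False by simp
qed

lemma facet_trace_separates:
  assumes "finite D" "nonpos_on D g" "y \<in> D" "g y \<noteq> 0"
  obtains T where "T \<in> facet_traces D" "tight D g \<subseteq> T" "y \<notin> T"
proof -
  obtain c where c: "\<And>T. T \<in> facet_traces D \<Longrightarrow> c T \<ge> 0"
    "\<And>u. u \<in> span D \<Longrightarrow> g u = (\<Sum>T\<in>facet_traces D. c T * trace_functional D T u)"
    using nonpos_on_conic_combination_span[OF assms(1,2)] by blast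
  have "(\<Sum>T\<in>facet_traces D. c T * trace_functional D T y) \<noteq> 0"
    using c(2)[of y] assms(3,4) by (simp add: span_base)
  then obtain T where T: "T \<in> facet_traces D" "c T * trace_functional D T y \<noteq> 0"
    by (meson sum.neutral)
  have "u \<in> T" if u: "u \<in> tight D g" for u
  proof -
    have uD: "u \<in> D" "g u = 0" using u by (auto simp: tight_def)
    have "(\<Sum>T\<in>facet_traces D. - (c T * trace_functional D T u)) = 0"
      using c(2)[of u] uD by (simp add: span_base sum_negf)
    then have "c T * trace_functional D T u = 0"
      using T(1) finite_facet_traces[OF assms(1)]
        mult_nonneg_nonpos[OF c(1) trace_functional_le[OF _ uD(1)]]
      by (subst (asm) sum_nonneg_eq_0_iff) auto
    then show ?thesis using T trace_functional_eq_0[OF T(1) uD(1)] by auto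
  qed
  with T assms(3) show thesis using trace_functional_eq_0[OF T(1)] by (intro that[of T]) auto
qed

section \<open>Faces of polytopes in arbitrary real vector spaces\<close>

text \<open>Any point of \<open>X\<close> that has positive weight in a convex combination lying in \<open>F\<close> lies in \<open>F\<close> itself,
  because the combination either is that point or lies inside a segment that ends there.\<close>

lemma face_of_convex_hull_finite:
  assumes "finite X" and F: "F face_of convex hull X"
  shows "F = convex hull (F \<inter> X)"
proof
  show "convex hull (F \<inter> X) \<subseteq> F"
    using F by (intro hull_minimal) (auto simp: face_of_def)
  show "F \<subseteq> convex hull (F \<inter> X)"
  proof
    fix y assume y: "y \<in> F"
    then have "y \<in> convex hull X" using F face_of_imp_subset by blast
    then obtain c where c: "\<forall>x\<in>X. 0 \<le> c x" "sum c X = 1" "(\<Sum>x\<in>X. c x *\<^sub>R x) = y"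
      using convex_hull_finite[OF assms(1)] by auto
    have mem: "x \<in> F" if x: "x \<in> X" "c x > 0" for x
    proof (cases "c x = 1")
      case True
      then have "sum c (X - {x}) = 0" using c(2) x(1) assms(1) by (simp add: sum_diff1)
      then have "\<forall>v\<in>X - {x}. c v = 0"
        using c(1) assms(1) by (subst (asm) sum_nonneg_eq_0_iff) auto
      then have "y = x"
        using c(3) x(1) assms(1) True by (simp add: sum.remove)
      then show ?thesis using y by simp
    next
      case False
      have rest: "sum c (X - {x}) = 1 - c x" using c(2) x(1) assms(1) by (simp add: sum_diff1)
      moreover have "sum c (X - {x}) \<ge> 0" using c(1) by (intro sum_nonneg) auto
      ultimately have lt: "c x < 1" using False by simp
      define z where "z = (\<Sum>v\<in>X - {x}. (c v / (1 - c x)) *\<^sub>R v)"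
      have "(\<Sum>v\<in>X - {x}. c v / (1 - c x)) = 1"
        using rest lt by (simp flip: sum_divide_distrib)
      then have "z \<in> convex hull (X - {x})"
        unfolding z_def using c(1) lt assms(1) 
        by (subst convex_hull_finite) (auto intro!: exI[of _ "\<lambda>v. c v / (1 - c x)"])
      then have z: "z \<in> convex hull X" using hull_mono[of "X - {x}" X convex] by blast
      have "(1 - c x) *\<^sub>R z = (\<Sum>v\<in>X - {x}. c v *\<^sub>R v)"
        using lt by (simp add: z_def scaleR_sum_right)
      then have yz: "y = (1 - c x) *\<^sub>R z + c x *\<^sub>R x"
        using c(3) x(1) assms(1) by (simp add: sum.remove add.commute)
      show ?thesis
      proof (cases "z = x")
        case True
        with yz have "y = x" by (simp flip: scaleR_left_distrib)
        with y show ?thesis by simp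
      next
        case False
        then have "y \<in> open_segment z x"
          using yz lt x(2) by (auto simp: in_segment)
        with F z y hull_inc[OF x(1)] show ?thesis by (meson face_ofD)
      qed
    qed
    have zero: "c x = 0" if "x \<in> X - F \<inter> X" for x
      using that mem[of x] c(1) by force
    have "sum c (F \<inter> X) = 1"
      using c(2) zero assms(1) by (subst sum.mono_neutral_left[of X]) auto
    moreover have "(\<Sum>x\<in>F \<inter> X. c x *\<^sub>R x) = y"
      unfolding c(3)[symmetric] using zero assms(1) by (intro sum.mono_neutral_left) auto
    ultimately show "y \<in> convex hull (F \<inter> X)"
      using c(1) assms(1) by (subst convex_hull_finite) auto
  qed
qed

lemma finite_facets:
  assumes "polytope Q"
  shows "finite {F. is_facet F Q}"
proof -
  obtain X where X: "finite X" "Q = convex hull X" using assms by (auto simp: polytope_def)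
  have "{F. is_facet F Q} \<subseteq> (\<lambda>Y. convex hull Y) ` Pow X"
  proof
    fix F assume "F \<in> {F. is_facet F Q}"
    then have "F = convex hull (F \<inter> X)"
      using face_of_convex_hull_finite[OF X(1)] by (simp add: is_facet_def X(2))
    then show "F \<in> (\<lambda>Y. convex hull Y) ` Pow X" by blast
  qed
  then show ?thesis using X(1) finite_subset by blast
qed

lemma affine_dim_convex_hull:
  assumes "x \<in> convex hull X"
  shows "affine_dim (convex hull X) = dim ((\<lambda>v. v - x) ` X)"
proof -
  let ?D = "(\<lambda>v. v - x) ` X"
  have "convex {a. a - x \<in> span ?D}"
  proof (rule convexI)
    fix a b and r s :: real
    assume "a \<in> {a. a - x \<in> span ?D}" "b \<in> {a. a - x \<in> span ?D}" "r + s = 1"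
    moreover from this have "r *\<^sub>R a + s *\<^sub>R b - x = r *\<^sub>R (a - x) + s *\<^sub>R (b - x)"
      by (simp add: algebra_simps flip: scaleR_left_distrib)
    ultimately show "r *\<^sub>R a + s *\<^sub>R b \<in> {a. a - x \<in> span ?D}"
      by (simp add: span_add span_scale)
  qed
  then have "convex hull X \<subseteq> {a. a - x \<in> span ?D}"
    by (intro hull_minimal) (auto intro: span_base)
  then have "a - b \<in> span ?D" if "a \<in> convex hull X" "b \<in> convex hull X" for a b
    using that span_diff[of "a - x" ?D "b - x"] by auto
  then have "{a - b | a b. a \<in> convex hull X \<and> b \<in> convex hull X} \<subseteq> span ?D" by blast
  moreover have "?D \<subseteq> {a - b | a b. a \<in> convex hull X \<and> b \<in> convex hull X}"
    using assms hull_inc by fast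
  then have "?D \<subseteq> span {a - b | a b. a \<in> convex hull X \<and> b \<in> convex hull X}"
    using span_superset by (rule subset_trans)
  ultimately show ?thesis
    unfolding affine_dim_def
    by (intro span_eq_dim subset_antisym span_minimal subspace_span)
qed

text \<open>The sets of maximizers of a linear functional, including the whole of \<open>Q\<close> for the zero functional
  and the empty set for a bound that is not attained.\<close>

definition exposed_in :: "'a::real_vector set \<Rightarrow> 'a set \<Rightarrow> bool" where
  "exposed_in G Q \<longleftrightarrow> (\<exists>l b. linear l \<and> (\<forall>q\<in>Q. l q \<le> (b::real)) \<and> G = {q \<in> Q. l q = b})"

lemma exposed_inI:
  "linear l \<Longrightarrow> (\<And>q. q \<in> Q \<Longrightarrow> l q \<le> b) \<Longrightarrow> G = {q \<in> Q. l q = (b::real)} \<Longrightarrow> exposed_in G Q"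
  unfolding exposed_in_def by blast

lemma exposed_in_face_of:
  assumes "convex Q" "exposed_in G Q"
  shows "G face_of Q"
proof -
  obtain l b where l: "linear l" "\<And>q. q \<in> Q \<Longrightarrow> l q \<le> (b::real)" "G = {q \<in> Q. l q = b}"
    using assms(2) by (auto simp: exposed_in_def)
  have G: "G = Q \<inter> l -` {b}" using l(3) by auto
  have "p \<in> G \<and> q \<in> G" if pq: "p \<in> Q" "q \<in> Q" "x \<in> G" "x \<in> open_segment p q" for p q x
  proof -
    obtain u where u: "0 < u" "u < 1" "x = (1 - u) *\<^sub>R p + u *\<^sub>R q"
      using pq(4) by (auto simp: in_segment)
    have "b = (1 - u) * l p + u * l q"
      using pq(3) l(3) by (simp add: u(3) linear_add[OF l(1)] linear_scale[OF l(1)])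
    then have "(1 - u) * (b - l p) + u * (b - l q) = 0" by (simp add: algebra_simps)
    moreover have "(1 - u) * (b - l p) \<ge> 0" "u * (b - l q) \<ge> 0"
      using u l(2)[OF pq(1)] l(2)[OF pq(2)] by simp_all
    ultimately have "(1 - u) * (b - l p) = 0" "u * (b - l q) = 0" by linarith+
    with u pq(1,2) l(3) show ?thesis by auto
  qed
  moreover have "convex G"
    unfolding G by (intro convex_Int assms(1) convex_linear_vimage[OF l(1)] convex_singleton)
  ultimately show ?thesis using G unfolding face_of_def by blast
qed

lemma exposed_in_Int:
  assumes "exposed_in G Q" "exposed_in H Q" "G \<inter> H \<noteq> {}"
  shows "exposed_in (G \<inter> H) Q"
proof -
  obtain l b where l: "linear l" "\<And>q. q \<in> Q \<Longrightarrow> l q \<le> (b::real)" "G = {q \<in> Q. l q = b}"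
    using assms(1) by (auto simp: exposed_in_def)
  obtain m d where m: "linear m" "\<And>q. q \<in> Q \<Longrightarrow> m q \<le> (d::real)" "H = {q \<in> Q. m q = d}"
    using assms(2) by (auto simp: exposed_in_def)
  show ?thesis
  proof (rule exposed_inI)
    show "linear (\<lambda>q. l q + m q)" using l(1) m(1) by (rule linear_compose_add)
    show "l q + m q \<le> b + d" if "q \<in> Q" for q
      using l(2)[OF that] m(2)[OF that] by simp
    show "G \<inter> H = {q \<in> Q. l q + m q = b + d}"
      unfolding l(3) m(3) using l(2) m(2) by force
  qed
qed

lemma linear_le_on_convex_hull:
  assumes "linear (l :: 'a::real_vector \<Rightarrow> real)" "\<And>v. v \<in> X \<Longrightarrow> l v \<le> b" "q \<in> convex hull X"
  shows "l q \<le> b"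
proof -
  have "convex (l -` {..b})" by (intro convex_linear_vimage assms(1)) auto
  then have "convex hull X \<subseteq> l -` {..b}" using assms(2) by (intro hull_minimal) auto
  with assms(3) show ?thesis by auto
qed

text \<open>A minimal nonempty exposed face is a point: on a face with two vertices, some functional takes
  different values at them, and perturbing the functional of the face by it exposes a smaller face.\<close>

lemma exposed_in_contains_exposed_point:
  assumes "polytope Q" "exposed_in G Q" "G \<noteq> {}"
  obtains x where "x \<in> G" "exposed_in {x} Q"
proof -
  obtain X where X: "finite X" "Q = convex hull X" using assms(1) by (auto simp: polytope_def)
  have "\<exists>x\<in>G. exposed_in {x} Q"
    using assms(2,3)
  proof (induction "card (G \<inter> X)" arbitrary: G rule: less_induct)
    case less
    have conv: "convex Q" by (simp add: X(2) convex_convex_hull)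
    have Ghull: "G = convex hull (G \<inter> X)"
      using face_of_convex_hull_finite[OF X(1)] exposed_in_face_of[OF conv less.prems(1)] X(2) by simp
    then have "G \<inter> X \<noteq> {}" using less.prems(2) by auto
    then obtain a where a: "a \<in> G" "a \<in> X" by blast
    show ?case
    proof (cases "G \<inter> X = {a}")
      case True
      with Ghull have "G = {a}" by simp
      with less.prems(1) show ?thesis by auto
    next
      case False
      then obtain c where c: "c \<in> G" "c \<in> X" "c \<noteq> a" using a by blast
      then have "c - a \<notin> span {}" by simp
      then obtain f :: "'a \<Rightarrow> real" where f: "linear f" "f (c - a) = 1"
        by (rule separating_functional) blast
      obtain l b where l: "linear l" "\<And>q. q \<in> Q \<Longrightarrow> l q \<le> (b::real)" "G = {q \<in> Q. l q = b}"
        using less.prems(1) by (auto simp: exposed_in_def)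
      define M where "M = Max (f ` (G \<inter> X))"
      have M: "f v \<le> M" if "v \<in> G \<inter> X" for v
        unfolding M_def using X(1) that by (intro Max_ge) auto
      have "M \<in> f ` (G \<inter> X)"
        unfolding M_def using X(1) a by (intro Max_in) auto
      then obtain w where w: "w \<in> G \<inter> X" "f w = M" by blast
      define D where "D = (\<lambda>v. v - w) ` X"
      have finD: "finite D" using X(1) by (simp add: D_def)
      have lw: "l w = b" and wQ: "w \<in> Q" using w l(3) by auto
      have "l v \<le> b" if "v \<in> X" for v using l(2) hull_inc[of v X convex] that X(2) by simp
      then have np: "nonpos_on D l"
        using l(1) lw by (auto simp: nonpos_on_def D_def linear_diff[OF l(1)])
      have fle: "f u \<le> 0" if u: "u \<in> D" "l u = 0" for u
      proof -
        obtain v where v: "v \<in> X" "u = v - w" using u(1) by (auto simp: D_def)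
        then have "l v = b" using u(2) lw by (simp add: linear_diff[OF l(1)])
        then have "v \<in> G" using v(1) hull_inc[of v X convex] by (simp add: l(3) X(2))
        then show ?thesis using M v w by (simp add: linear_diff[OF f(1)])
      qed
      obtain K where K: "nonpos_on D (\<lambda>u. K * l u + f u)"
        using nonpos_on_dominate[OF finD np f(1) fle] .
      \<comment> \<open>K makes w a maximizer; one more summand l excludes maximizers outside G\<close>
      define k where "k = (\<lambda>u. (K + 1) * l u + f u)"
      have link: "linear k"
        unfolding k_def using l(1) f(1)
          linear_compose_add[of "\<lambda>u. (K + 1) *\<^sub>R l u" f] linear_compose_scale_right[of l "K + 1"]
        by simp
      have linK: "linear (\<lambda>u. K * l u + f u)" using K by (simp add: nonpos_on_def)
      have KX: "K * l q + f q \<le> K * b + M" if "q \<in> Q" for q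
      proof (rule linear_le_on_convex_hull[OF linK])
        show "q \<in> convex hull X" using that X(2) by simp
        fix v assume "v \<in> X"
        then have "K * l (v - w) + f (v - w) \<le> 0" using K by (auto simp: nonpos_on_def D_def)
        then show "K * l v + f v \<le> K * b + M"
          using lw w(2) by (simp add: linear_diff[OF l(1)] linear_diff[OF f(1)] algebra_simps)
      qed
      define G' where "G' = {q \<in> Q. k q = (K + 1) * b + M}"
      have ex: "exposed_in G' Q"
      proof (rule exposed_inI[OF link _ G'_def])
        show "k q \<le> (K + 1) * b + M" if "q \<in> Q" for q
          using KX[OF that] l(2)[OF that] by (simp add: k_def algebra_simps)
      qed
      have sub: "q \<in> G" "f q = M" if "q \<in> G'" for q
      proof -
        have q: "q \<in> Q" "k q = (K + 1) * b + M" using that by (auto simp: G'_def)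
        then show "q \<in> G" using KX[OF q(1)] l(2)[OF q(1)] by (simp add: k_def l(3) algebra_simps)
        then show "f q = M" using q by (simp add: k_def l(3))
      qed
      have "w \<in> G'" using wQ lw w(2) by (simp add: G'_def k_def)
      have "\<not> (a \<in> G' \<and> c \<in> G')"
        using sub(2)[of a] sub(2)[of c] f by (auto simp: linear_diff)
      then have "G' \<inter> X \<subset> G \<inter> X" using sub(1) a c by blast
      then have "card (G' \<inter> X) < card (G \<inter> X)" using X(1) by (intro psubset_card_mono) auto
      from less.hyps[OF this ex] \<open>w \<in> G'\<close> obtain x where "x \<in> G'" "exposed_in {x} Q" by blast
      with sub(1) show ?thesis by blast
    qed
  qed
  with that show thesis by blast
qed

section \<open>Facets of polytopes\<close>

lemma exposed_in_nonpos_on: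
  assumes l: "linear l" "\<And>q. q \<in> convex hull X \<Longrightarrow> l q \<le> (b::real)" and x: "l x = b"
  shows "nonpos_on ((\<lambda>v. v - x) ` X) l"
    "tight ((\<lambda>v. v - x) ` X) l = (\<lambda>v. v - x) ` ({q \<in> convex hull X. l q = b} \<inter> X)"
proof -
  show "nonpos_on ((\<lambda>v. v - x) ` X) l"
    using l x hull_inc[of _ X convex] by (auto simp: nonpos_on_def linear_diff)
  show "tight ((\<lambda>v. v - x) ` X) l = (\<lambda>v. v - x) ` ({q \<in> convex hull X. l q = b} \<inter> X)"
    using x hull_inc[of _ X convex] by (auto simp: tight_def linear_diff[OF l(1)])
qed

lemma affine_dim_exposed:
  assumes "finite X" and l: "linear l" "\<And>q. q \<in> convex hull X \<Longrightarrow> l q \<le> (b::real)"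
    and x: "x \<in> convex hull X" "l x = b"
  shows "affine_dim {q \<in> convex hull X. l q = b} = dim (tight ((\<lambda>v. v - x) ` X) l)"
proof -
  let ?F = "{q \<in> convex hull X. l q = b}"
  have "?F face_of convex hull X"
    using l by (intro exposed_in_face_of convex_convex_hull exposed_inI) auto
  then have hull: "?F = convex hull (?F \<inter> X)"
    by (rule face_of_convex_hull_finite[OF assms(1)])
  then have "x \<in> convex hull (?F \<inter> X)" using x by blast
  from affine_dim_convex_hull[OF this] hull show ?thesis
    using exposed_in_nonpos_on(2)[OF l x(2)] by simp
qed

lemma facet_trace_imp_facet:
  assumes "finite X" "x \<in> convex hull X" and T: "T \<in> facet_traces ((\<lambda>v. v - x) ` X)"
  defines "F \<equiv> {q \<in> convex hull X. trace_functional ((\<lambda>v. v - x) ` X) T q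
      = trace_functional ((\<lambda>v. v - x) ` X) T x}"
  shows "exposed_in F (convex hull X)" "is_facet F (convex hull X)" "x \<in> F"
    "T = (\<lambda>v. v - x) ` (F \<inter> X)"
proof -
  let ?m = "trace_functional ((\<lambda>v. v - x) ` X) T"
  note m = trace_functional[OF T] 
  have lin: "linear ?m" using T by (rule trace_functional_linear)
  have le: "?m q \<le> ?m x" if "q \<in> convex hull X" for q
  proof (rule linear_le_on_convex_hull[OF lin _ that])
    fix v assume "v \<in> X"
    then show "?m v \<le> ?m x" using trace_functional_le[OF T, of "v - x"] by (simp add: linear_diff[OF lin])
  qed
  show ex: "exposed_in F (convex hull X)"
    unfolding F_def by (rule exposed_inI[OF lin le]) auto
  show x: "x \<in> F" using assms(2) by (simp add: F_def)
  have "affine_dim F = dim T"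
    using affine_dim_exposed[OF assms(1) lin le assms(2) refl] m(2) by (simp add: F_def)
  moreover have "dim T + 1 = affine_dim (convex hull X)"
    using m affine_dim_convex_hull[OF assms(2)] by (simp add: facet_functional_def)
  ultimately show "is_facet F (convex hull X)"
    unfolding is_facet_def using exposed_in_face_of[OF convex_convex_hull ex] x by auto
  show "T = (\<lambda>v. v - x) ` (F \<inter> X)"
    using exposed_in_nonpos_on(2)[OF lin le refl] m(2) by (simp add: F_def)
qed

text \<open>The property of simple polytopes on which the lower bound rests.  It is transferred from
  \<open>facet_trace_prime\<close> at an exposed vertex \<open>x\<close> of the intersection, where simplicity bounds the number of
  facet functionals by the dimension.\<close>

lemma facet_prime:
  assumes Q: "simple_polytope Q"
    and F: "exposed_in F Q" "is_facet F Q" and G: "exposed_in G Q" and H: "exposed_in H Q"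
    and ne: "G \<inter> H \<noteq> {}" and sub: "G \<inter> H \<subseteq> F"
  shows "G \<subseteq> F \<or> H \<subseteq> F"
proof -
  have poly: "polytope Q" using Q by (simp add: simple_polytope_def)
  then obtain X where X: "finite X" "Q = convex hull X" by (auto simp: polytope_def)
  have conv: "convex Q" by (simp add: X(2) convex_convex_hull)
  obtain x where x: "x \<in> G \<inter> H" "exposed_in {x} Q"
    using exposed_in_contains_exposed_point[OF poly exposed_in_Int[OF G H ne] ne] by blast
  define D where "D = (\<lambda>v. v - x) ` X"
  have finD: "finite D" using X(1) by (simp add: D_def)
  obtain l0 b0 where l0: "linear l0" "\<And>q. q \<in> Q \<Longrightarrow> l0 q \<le> (b0::real)" "{x} = {q \<in> Q. l0 q = b0}"
    using x(2) by (auto simp: exposed_in_def)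
  have xQ: "x \<in> Q" "l0 x = b0" using l0(3) by auto
  have np: "nonpos_on D l0"
    unfolding D_def using l0(2) xQ(2) by (intro exposed_in_nonpos_on(1)[OF l0(1)]) (simp_all add: X(2))
  have neg: "l0 u < 0" if u: "u \<in> D" "u \<noteq> 0" for u
  proof -
    obtain v where v: "v \<in> X" "u = v - x" using u by (auto simp: D_def)
    then have "v \<in> Q" "v \<noteq> x" using u(2) hull_inc[of v X convex] X(2) by auto
    then have "l0 v \<le> b0" "l0 v \<noteq> b0" using l0 by auto
    then show ?thesis using v xQ by (simp add: linear_diff[OF l0(1)])
  qed
  have "x extreme_point_of Q"
    using exposed_in_face_of[OF conv x(2)] by (simp add: face_of_singleton)
  then have "card {F. is_facet F Q \<and> x \<in> F} = affine_dim Q"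
    using Q by (simp add: simple_polytope_def)
  also have "\<dots> = dim D" using affine_dim_convex_hull[of x X] xQ X(2) by (simp add: D_def)
  finally have cardx: "card {F. is_facet F Q \<and> x \<in> F} = dim D" .
  have card: "card (facet_traces D) \<le> dim D"
  proof -
    define \<phi> where "\<phi> T = {q \<in> Q. trace_functional D T q = trace_functional D T x}" for T
    have \<phi>: "is_facet (\<phi> T) Q" "x \<in> \<phi> T" "T = (\<lambda>v. v - x) ` (\<phi> T \<inter> X)" if "T \<in> facet_traces D" for T
      using facet_trace_imp_facet[OF X(1), of x T] that xQ X(2) by (simp_all add: \<phi>_def D_def)
    have "inj_on \<phi> (facet_traces D)"
      using \<phi>(3)[symmetric] by (rule inj_on_inverseI)
    moreover have "\<phi> ` facet_traces D \<subseteq> {F. is_facet F Q \<and> x \<in> F}" using \<phi>(1,2) by blast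
    moreover have "finite {F. is_facet F Q \<and> x \<in> F}"
      by (rule finite_subset[OF _ finite_facets[OF poly]]) blast
    ultimately show ?thesis unfolding cardx[symmetric] by (rule card_inj_on_le)
  qed
  have trace: "\<exists>g. nonpos_on D g \<and> tight D g = (\<lambda>v. v - x) ` (A \<inter> X) \<and> dim (tight D g) = affine_dim A"
    if A: "exposed_in A Q" "x \<in> A" for A
  proof -
    obtain l b where l: "linear l" "\<And>q. q \<in> Q \<Longrightarrow> l q \<le> (b::real)" "A = {q \<in> Q. l q = b}"
      using A(1) by (auto simp: exposed_in_def)
    then have lx: "l x = b" using A(2) by simp
    have le: "l q \<le> b" if "q \<in> convex hull X" for q using l(2) that X(2) by simp
    have "A = {q \<in> convex hull X. l q = b}" using l(3) X(2) by simp
    moreover have "x \<in> convex hull X" using xQ X(2) by simp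
    ultimately show ?thesis
      using exposed_in_nonpos_on[OF l(1) le lx] affine_dim_exposed[OF X(1) l(1) le _ lx]
      unfolding D_def by metis
  qed
  have xF: "x \<in> F" using x sub by blast
  obtain f where f: "nonpos_on D f" "tight D f = (\<lambda>v. v - x) ` (F \<inter> X)" "dim (tight D f) = affine_dim F"
    using trace[OF F(1) xF] by blast
  have "affine_dim F + 1 = dim D"
    using F(2) affine_dim_convex_hull[of x X] xQ X(2) by (simp add: is_facet_def D_def)
  then have "facet_functional D f" using f(1,3) by (simp add: facet_functional_def)
  then have f': "tight D f \<in> facet_traces D" by (auto simp: facet_traces_def)
  obtain g where g: "nonpos_on D g" "tight D g = (\<lambda>v. v - x) ` (G \<inter> X)" using trace[OF G] x by blast
  obtain h where h: "nonpos_on D h" "tight D h = (\<lambda>v. v - x) ` (H \<inter> X)" using trace[OF H] x by blast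
  have shift: "inj (\<lambda>v. v - x)" by (rule injI) simp
  have gh: "tight D g \<inter> tight D h \<subseteq> tight D f"
    unfolding f(2) g(2) h(2) using sub by (auto simp flip: image_Int[OF shift])
  have "tight D g \<subseteq> tight D f \<or> tight D h \<subseteq> tight D f"
    using neg by (rule facet_trace_prime[OF finD np _ card f' g(1) h(1) gh])
  then have "G \<inter> X \<subseteq> F \<or> H \<inter> X \<subseteq> F"
    unfolding f(2) g(2) h(2) inj_image_subset_iff[OF shift] by blast
  moreover have "A \<subseteq> F" if "exposed_in A Q" "A \<inter> X \<subseteq> F" for A
  proof -
    have "A = convex hull (A \<inter> X)"
      using face_of_convex_hull_finite[OF X(1)] exposed_in_face_of[OF conv that(1)] X(2) by simp
    also have "\<dots> \<subseteq> F"
      using that(2) F(2) by (intro hull_minimal) (auto simp: is_facet_def face_of_def)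
    finally show ?thesis .
  qed
  ultimately show ?thesis using G H by blast
qed

text \<open>The functional exposing \<open>G\<close> is a conic combination of facet functionals at a point of \<open>G\<close>, and one
  of its terms must be negative at \<open>p\<close>.  Adding \<open>p\<close> to the generators of \<open>Q\<close> makes it available to the
  argument about generators without assuming that it is a vertex.\<close>

lemma facet_separates:
  assumes "polytope Q" and G: "exposed_in G Q" "G \<noteq> {}" and p: "p \<in> Q" "p \<notin> G"
  obtains F where "exposed_in F Q" "is_facet F Q" "G \<subseteq> F" "p \<notin> F"
proof -
  obtain X0 where X0: "finite X0" "Q = convex hull X0" using assms(1) by (auto simp: polytope_def)
  define X where "X = insert p X0"
  have X: "finite X" "Q = convex hull X" "p \<in> X"
    using X0 p hull_redundant[of p convex X0] by (auto simp: X_def)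
  obtain x where x: "x \<in> G" using G(2) by blast
  define D where "D = (\<lambda>v. v - x) ` X"
  have finD: "finite D" using X(1) by (simp add: D_def)
  obtain l b where l: "linear l" "\<And>q. q \<in> Q \<Longrightarrow> l q \<le> (b::real)" "G = {q \<in> Q. l q = b}"
    using G(1) by (auto simp: exposed_in_def)
  have xQ: "x \<in> Q" "l x = b" using x l(3) by auto
  have np: "nonpos_on D l" "tight D l = (\<lambda>v. v - x) ` (G \<inter> X)"
    using exposed_in_nonpos_on[of l X b x] l xQ by (simp_all add: D_def X(2))
  have "p - x \<in> D" using X(3) by (simp add: D_def)
  moreover have "l (p - x) \<noteq> 0" using p xQ l(3) by (simp add: linear_diff[OF l(1)])
  ultimately obtain T where T: "T \<in> facet_traces D" "tight D l \<subseteq> T" "p - x \<notin> T"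
    using facet_trace_separates[OF finD np(1)] by blast
  define F where "F = {q \<in> Q. trace_functional D T q = trace_functional D T x}"
  have F: "exposed_in F Q" "is_facet F Q" "T = (\<lambda>v. v - x) ` (F \<inter> X)"
    using facet_trace_imp_facet[OF X(1), of x T] T(1) xQ X(2) by (simp_all add: F_def D_def)
  have "p \<notin> F" using T(3) F(3) X(3) by auto
  moreover have "G \<subseteq> F"
  proof -
    have "convex Q" by (simp add: X(2) convex_convex_hull)
    then have "G = convex hull (G \<inter> X)"
      using face_of_convex_hull_finite[OF X(1)] exposed_in_face_of[OF _ G(1)] X(2) by simp
    also have "\<dots> \<subseteq> F"
      using T(2) F(2,3) np(2) by (intro hull_minimal) (auto simp: is_facet_def face_of_def)
    finally show ?thesis .
  qed
  ultimately show thesis using that F by blast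
qed

section \<open>The lower bound for simple extensions\<close>

definition face_closed :: "'a::real_vector set \<Rightarrow> 'a set \<Rightarrow> bool" where
  "face_closed P W \<longleftrightarrow> (\<forall>A B p. exposed_in A P \<longrightarrow> exposed_in B P \<longrightarrow>
     A \<inter> W \<noteq> {} \<longrightarrow> B \<inter> W \<noteq> {} \<longrightarrow> A \<inter> B = {p} \<longrightarrow> p \<in> W)"

lemma exposed_in_linear_vimage:
  assumes "linear \<pi>" "exposed_in A (\<pi> ` Q)"
  shows "exposed_in {q \<in> Q. \<pi> q \<in> A} Q"
proof -
  obtain l b where l: "linear l" "\<And>p. p \<in> \<pi> ` Q \<Longrightarrow> l p \<le> (b::real)" "A = {p \<in> \<pi> ` Q. l p = b}"
    using assms(2) by (auto simp: exposed_in_def)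
  show ?thesis
    by (rule exposed_inI[of "l \<circ> \<pi>" Q b]) (use l assms(1) linear_compose in auto)
qed

text \<open>Each \<open>i\<close> has a facet that contains the fibre of \<open>w i\<close> and avoids \<open>v i\<close>.  If \<open>i\<close> and \<open>j\<close> shared this
  facet, it would avoid both \<open>v i\<close> and \<open>v j\<close>, hence also \<open>w i\<close>.\<close>

theorem simple_extension_lower_bound:
  assumes Q: "simple_polytope Q" "is_extension Q P"
    and v: "\<And>i. i \<in> I \<Longrightarrow> v i \<in> P"
    and w: "\<And>i. i \<in> I \<Longrightarrow> exposed_in {w i} P" "\<And>i. i \<in> I \<Longrightarrow> w i \<noteq> v i"
    and closed: "\<And>W i j. face_closed P W \<Longrightarrow> i \<in> I \<Longrightarrow> j \<in> I \<Longrightarrow> i \<noteq> j \<Longrightarrow>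
      v i \<in> W \<Longrightarrow> v j \<in> W \<Longrightarrow> w i \<in> W"
  shows "card I \<le> num_facets Q"
proof -
  obtain \<pi> where \<pi>: "linear \<pi>" "P = \<pi> ` Q" using Q(2) by (auto simp: is_extension_def)
  have poly: "polytope Q" using Q(1) by (simp add: simple_polytope_def)
  define W where "W F = {p \<in> P. \<exists>q\<in>Q. \<pi> q = p \<and> q \<notin> F}" for F
  have W: "face_closed P (W F)" if F: "exposed_in F Q" "is_facet F Q" for F
    unfolding face_closed_def
  proof (intro allI impI)
    fix A B p
    assume A: "exposed_in A P" "A \<inter> W F \<noteq> {}" and B: "exposed_in B P" "B \<inter> W F \<noteq> {}"
      and AB: "A \<inter> B = {p}"
    have p: "p \<in> P" using A(1) AB by (auto simp: exposed_in_def)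
    have "\<not> {q \<in> Q. \<pi> q \<in> A} \<subseteq> F" "\<not> {q \<in> Q. \<pi> q \<in> B} \<subseteq> F" using A(2) B(2) by (auto simp: W_def)
    moreover have "{q \<in> Q. \<pi> q \<in> A} \<inter> {q \<in> Q. \<pi> q \<in> B} = {q \<in> Q. \<pi> q = p}" using AB by auto
    moreover have "{q \<in> Q. \<pi> q = p} \<noteq> {}" using p \<pi>(2) by auto
    ultimately have "\<not> {q \<in> Q. \<pi> q = p} \<subseteq> F"
      using facet_prime[OF Q(1) F exposed_in_linear_vimage[OF \<pi>(1)] exposed_in_linear_vimage[OF \<pi>(1)], of A B]
        A(1) B(1) \<pi>(2) by auto
    then show "p \<in> W F" using p by (auto simp: W_def)
  qed
  have "\<exists>F. exposed_in F Q \<and> is_facet F Q \<and> v i \<in> W F \<and> w i \<notin> W F" if i: "i \<in> I" for i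
  proof -
    have "w i \<in> P" using w(1)[OF i] by (auto simp: exposed_in_def)
    then have "{q \<in> Q. \<pi> q \<in> {w i}} \<noteq> {}" using \<pi>(2) by auto
    moreover obtain q where q: "q \<in> Q" "\<pi> q = v i" using v[OF i] \<pi>(2) by auto
    moreover have "q \<notin> {q \<in> Q. \<pi> q \<in> {w i}}" using q w(2)[OF i] by auto
    moreover have "exposed_in {q \<in> Q. \<pi> q \<in> {w i}} Q"
      using w(1)[OF i] \<pi>(2) by (intro exposed_in_linear_vimage[OF \<pi>(1)]) simp
    ultimately obtain F where F: "exposed_in F Q" "is_facet F Q" "{q \<in> Q. \<pi> q \<in> {w i}} \<subseteq> F" "q \<notin> F"
      using facet_separates[OF poly, of "{q \<in> Q. \<pi> q \<in> {w i}}" q] by blast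
    with q v[OF i] show ?thesis by (intro exI[of _ F]) (auto simp: W_def)
  qed
  then obtain F where F: "\<And>i. i \<in> I \<Longrightarrow> exposed_in (F i) Q" "\<And>i. i \<in> I \<Longrightarrow> is_facet (F i) Q"
    "\<And>i. i \<in> I \<Longrightarrow> v i \<in> W (F i)" "\<And>i. i \<in> I \<Longrightarrow> w i \<notin> W (F i)"
    by metis
  have "inj_on F I"
  proof (rule inj_onI, rule ccontr)
    fix i j assume ij: "i \<in> I" "j \<in> I" "F i = F j" "i \<noteq> j"
    then have "w i \<in> W (F i)" using closed[OF W[OF F(1,2)]] F(3)[of i] F(3)[of j] by metis
    with F(4) ij show False by blast
  qed
  moreover have "F ` I \<subseteq> {F. is_facet F Q}" using F(2) by blast
  ultimately show ?thesis
    unfolding num_facets_def using finite_facets[OF poly] card_inj_on_le by blast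
qed

section \<open>Existence of simple extensions\<close>

lemma dim_differences_independent:
  fixes E :: "'a::real_vector set"
  assumes "finite E" "independent E" "y \<in> E"
  shows "dim ((\<lambda>v. v - y) ` E) + 1 = card E"
proof -
  let ?D = "(\<lambda>v. v - y) ` E"
  obtain f :: "'a \<Rightarrow> real" where f: "linear f" "\<forall>v\<in>E. f v = 1"
    using linear_independent_extend[OF assms(2), of "\<lambda>_. 1"] by blast
  have "f u = 0" if "u \<in> span ?D" for u
    using that by (rule linear_eq_0_on_span[OF f(1), rotated]) (use f(2) assms(3) in \<open>auto simp: linear_diff[OF f(1)]\<close>)
  then have "y \<notin> span ?D" using f(2) assms(3) by force
  then have "dim (insert y ?D) = dim ?D + 1" using assms(1) by (intro dim_insert_finite) auto
  moreover have "span (insert y ?D) = span E"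
  proof (intro subset_antisym span_minimal subspace_span)
    show "insert y ?D \<subseteq> span E" using assms(3) by (auto intro: span_base span_diff)
    show "E \<subseteq> span (insert y ?D)"
    proof
      fix v assume "v \<in> E"
      then have "(v - y) + y \<in> span (insert y ?D)" by (intro span_add) (auto intro: span_base)
      then show "v \<in> span (insert y ?D)" by simp
    qed
  qed
  ultimately show ?thesis
    using dim_eq_card_independent[OF assms(2)] span_eq_dim by metis
qed

text \<open>The facets of a simplex are the hulls of all vertices but one; a vertex lies on all of them except
  the one opposite to it.\<close>

lemma simplex_simple:
  fixes E :: "'a::real_vector set"
  assumes "finite E" "independent E"
  shows "simple_polytope (convex hull E)"
proof -
  let ?Q = "convex hull E"
  have adim: "affine_dim (convex hull Y) + 1 = card Y" if "Y \<subseteq> E" "Y \<noteq> {}" for Y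
  proof -
    obtain y where "y \<in> Y" using \<open>Y \<noteq> {}\<close> by blast
    moreover have "independent Y" "finite Y"
      using that assms independent_mono finite_subset by blast+
    ultimately show ?thesis
      using affine_dim_convex_hull[OF hull_inc[of y Y convex]] dim_differences_independent[of Y y] by simp
  qed
  have opp: "exposed_in (convex hull (E - {y})) ?Q \<and> convex hull (E - {y}) \<inter> E = E - {y}" if y: "y \<in> E" for y
  proof -
    obtain f :: "'a \<Rightarrow> real" where f: "linear f" "\<forall>v\<in>E. f v = (if v = y then - 1 else 0)"
      using linear_independent_extend[OF assms(2), of "\<lambda>v. if v = y then - 1 else 0"] by blast
    let ?F = "{q \<in> ?Q. f q = 0}"
    have ex: "exposed_in ?F ?Q"
      by (rule exposed_inI[OF f(1) linear_le_on_convex_hull[OF f(1)] refl]) (use f(2) in auto)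
    have FE: "?F \<inter> E = E - {y}" using f(2) hull_inc[of _ E convex] by auto
    have "?F = convex hull (E - {y})"
      using face_of_convex_hull_finite[OF assms(1) exposed_in_face_of[OF convex_convex_hull ex]] FE
      by simp
    with ex FE show ?thesis by simp
  qed
  have "card {F. is_facet F ?Q \<and> x \<in> F} = affine_dim ?Q" if x: "x extreme_point_of ?Q" for x
  proof -
    have xE: "x \<in> E" using x by (rule extreme_point_of_convex_hull)
    have "{F. is_facet F ?Q \<and> x \<in> F} = (\<lambda>y. convex hull (E - {y})) ` (E - {x})"
    proof (intro subset_antisym subsetI)
      fix F assume "F \<in> {F. is_facet F ?Q \<and> x \<in> F}"
      then have F: "F face_of ?Q" "affine_dim F + 1 = affine_dim ?Q" "x \<in> F" by (auto simp: is_facet_def)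
      define Y where "Y = F \<inter> E"
      have FY: "F = convex hull Y" using face_of_convex_hull_finite[OF assms(1) F(1)] by (simp add: Y_def)
      have Y: "Y \<subseteq> E" "x \<in> Y" using xE F(3) by (auto simp: Y_def)
      have "affine_dim (convex hull Y) + 1 = affine_dim ?Q" using F(2) FY by simp
      moreover have "Y \<noteq> {}" "E \<noteq> {}" using Y(2) xE by auto
      ultimately have "card Y + 1 = card E"
        using adim[OF Y(1)] adim[OF order_refl] by linarith
      then have "card (E - Y) = 1"
        using Y(1) assms(1) by (subst card_Diff_subset) (auto intro: finite_subset)
      then obtain y where "E - Y = {y}" by (rule card_1_singletonE)
      then have "y \<in> E - {x}" "Y = E - {y}" using Y by blast+
      then show "F \<in> (\<lambda>y. convex hull (E - {y})) ` (E - {x})"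
        unfolding FY by (intro image_eqI[of _ _ y]) simp_all
    next
      fix F assume "F \<in> (\<lambda>y. convex hull (E - {y})) ` (E - {x})"
      then obtain y where y: "y \<in> E" "y \<noteq> x" "F = convex hull (E - {y})" by blast
      have xF: "x \<in> F" using xE y by (simp add: hull_inc)
      have "F face_of ?Q"
        unfolding y(3) using opp[OF y(1)] by (intro exposed_in_face_of convex_convex_hull) simp
      moreover have "E - {y} \<noteq> {}" "E \<noteq> {}" using xE y(2) by auto
      then have "affine_dim F + 1 = affine_dim ?Q"
        using adim[OF Diff_subset, of "{y}"] adim[OF order_refl] card.remove[OF assms(1) y(1)]
        unfolding y(3) by linarith
      ultimately show "F \<in> {F. is_facet F ?Q \<and> x \<in> F}"
        using xF by (auto simp: is_facet_def)
    qed
    moreover have "inj_on (\<lambda>y. convex hull (E - {y})) (E - {x})"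
    proof (rule inj_onI)
      fix y z assume "y \<in> E - {x}" "z \<in> E - {x}" "convex hull (E - {y}) = convex hull (E - {z})"
      then have "E - {y} = E - {z}" using opp[of y] opp[of z] by (metis DiffD1)
      then show "y = z" using \<open>y \<in> E - {x}\<close> by blast
    qed
    moreover have "card (E - {x}) = affine_dim ?Q"
      using adim[OF order_refl] xE assms(1) by (subst card_Diff_singleton) force+
    ultimately show ?thesis by (simp add: card_image)
  qed
  then show ?thesis
    unfolding simple_polytope_def by (intro conjI allI impI polytope_convex_hull assms(1))
qed

lemma simple_extension_exists:
  assumes "polytope P"
  shows "\<exists>Q :: (nat \<Rightarrow>\<^sub>0 real) set. simple_polytope Q \<and> is_extension Q P"
proof -
  obtain X where X: "finite X" "P = convex hull X" using assms by (auto simp: polytope_def)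
  obtain h where h: "bij_betw h {..<card X} X"
    using bij_betw_from_nat_into_finite[OF X(1)] by blast
  define e :: "nat \<Rightarrow> nat \<Rightarrow>\<^sub>0 real" where "e i = Poly_Mapping.single i 1" for i
  have inj: "inj e" unfolding e_def by (rule injI) (metis lookup_single_eq lookup_single_not_eq zero_neq_one)
  define E where "E = e ` {..<card X}"
  have finE: "finite E" by (simp add: E_def)
  have "independent E"
  proof (rule independent_if_scalars_zero[OF finE])
    fix c x assume sum: "(\<Sum>x\<in>E. c x *\<^sub>R x) = 0" and "x \<in> E"
    then obtain i where i: "i < card X" "x = e i" by (auto simp: E_def)
    have "0 = Poly_Mapping.lookup (\<Sum>j<card X. c (e j) *\<^sub>R e j) i"
      using sum inj by (simp add: E_def sum.reindex inj_on_subset)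
    also have "\<dots> = (\<Sum>j<card X. if j = i then c (e j) else 0)"
      unfolding lookup_sum by (intro sum.cong) (auto simp: lookup_scaleR e_def lookup_single when_def)
    also have "\<dots> = c x" using i by simp
    finally show "c x = 0" by simp
  qed
  then have simple: "simple_polytope (convex hull E)" using finE by (intro simplex_simple)
  obtain \<pi> where \<pi>: "linear \<pi>" "\<forall>x\<in>E. \<pi> x = h (inv e x)"
    using linear_independent_extend[OF \<open>independent E\<close>, of "\<lambda>x. h (inv e x)"] by blast
  have "\<pi> ` E = X"
    using \<pi>(2) inj bij_betw_imp_surj_on[OF h] by (simp add: E_def image_image)
  then have "\<pi> ` (convex hull E) = P" using convex_hull_linear_image[OF \<pi>(1)] X(2) by metis
  with simple \<pi>(1) show ?thesis
    unfolding is_extension_def by (auto simp: simple_polytope_def)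
qed

lemma sxc_lower_bound:
  assumes "polytope P"
    and "\<And>Q :: (nat \<Rightarrow>\<^sub>0 real) set. simple_polytope Q \<Longrightarrow> is_extension Q P \<Longrightarrow> k \<le> num_facets Q"
  shows "k \<le> sxc P"
proof -
  have "\<exists>s. \<exists>Q :: (nat \<Rightarrow>\<^sub>0 real) set. simple_polytope Q \<and> is_extension Q P \<and> num_facets Q = s"
    using simple_extension_exists[OF assms(1)] by blast
  from LeastI_ex[OF this] obtain Q :: "(nat \<Rightarrow>\<^sub>0 real) set"
    where "simple_polytope Q" "is_extension Q P" "num_facets Q = sxc P"
    unfolding sxc_def by blast
  with assms(2) show ?thesis by metis
qed

section \<open>Spanning trees and their polytope\<close>

text \<open>The rank makes the parent map lead to the root, and it excludes cycles: both neighbours of a vertex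
  of maximal rank on a cycle would be its parent, although they are different.\<close>

lemma parent_map_spanning_tree:
  fixes p rk :: "nat \<Rightarrow> nat"
  assumes r: "r < n" and p: "\<And>v. v < n \<Longrightarrow> v \<noteq> r \<Longrightarrow> p v < n \<and> rk (p v) < rk v"
  shows "spanning_tree n ((\<lambda>v. {v, p v}) ` ({..<n} - {r}))"
proof -
  define T where "T = (\<lambda>v. {v, p v}) ` ({..<n} - {r})"
  define R where "R = {(a, b). {a, b} \<in> T}"
  have "sym (R\<^sup>*)" by (intro sym_rtrancl symI) (auto simp: R_def insert_commute)
  have to_root: "(v, r) \<in> R\<^sup>*" if "v < n" for v
    using that
  proof (induction "rk v" arbitrary: v rule: less_induct)
    case less
    show ?case
    proof (cases "v = r")
      case False
      then have "(v, p v) \<in> R" using less.prems by (auto simp: R_def T_def)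
      with less.hyps p[OF less.prems False] show ?thesis by (meson converse_rtrancl_into_rtrancl)
    qed simp
  qed
  have "graph_connected {..<n} T"
    unfolding graph_connected_def R_def[symmetric]
    using to_root \<open>sym (R\<^sup>*)\<close> by (meson lessThan_iff rtrancl_trans symD)
  moreover have "T \<subseteq> complete_edges n"
  proof
    fix e assume "e \<in> T"
    then obtain v where v: "v < n" "v \<noteq> r" "e = {v, p v}" by (auto simp: T_def)
    then have "p v \<noteq> v" using p[of v] by auto
    with v p[of v] show "e \<in> complete_edges n" by (auto simp: complete_edges_def)
  qed
  moreover have "\<not> graph_cycle T vs" for vs
  proof
    assume "graph_cycle T vs"
    then have vs: "3 \<le> length vs" "distinct vs"
      "\<And>i. i < length vs \<Longrightarrow> {vs ! i, vs ! (Suc i mod length vs)} \<in> T"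
      by (auto simp: graph_cycle_def)
    define M where "M = Max (rk ` set vs)"
    have "M \<in> rk ` set vs" unfolding M_def using vs(1) by (intro Max_in) auto
    then obtain k where k: "k < length vs" "rk (vs ! k) = M" by (auto simp: in_set_conv_nth)
    \<comment> \<open>both neighbours of a vertex of maximal rank are its parent\<close>
    have parent: "vs ! j = p (vs ! k)" if j: "j < length vs" "{vs ! j, vs ! k} \<in> T" for j
    proof -
      obtain v where v: "v < n" "v \<noteq> r" "{vs ! j, vs ! k} = {v, p v}" using j(2) by (auto simp: T_def)
      have "rk (vs ! j) \<le> rk (vs ! k)" unfolding k(2) M_def using j(1) by (intro Max_ge) auto
      moreover have "rk (p v) < rk v" using p[OF v(1,2)] by simp
      moreover have "vs ! j = v \<and> vs ! k = p v \<or> vs ! j = p v \<and> vs ! k = v"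
        using v(3) unfolding doubleton_eq_iff .
      ultimately show ?thesis by force
    qed
    define j where "j = (if k = 0 then length vs - 1 else k - 1)"
    define l where "l = Suc k mod length vs"
    have j: "j < length vs" "Suc j mod length vs = k" using k(1) vs(1) by (cases "k = 0"; simp add: j_def; arith)+
    have l: "l < length vs" unfolding l_def using vs(1) by (intro mod_less_divisor) linarith
    have "j \<noteq> l"
    proof (cases "Suc k = length vs")
      case True
      then show ?thesis using vs(1) by (auto simp: j_def l_def)
    next
      case False
      then have "l = Suc k" using k(1) by (simp add: l_def)
      then show ?thesis using vs(1) False by (auto simp: j_def)
    qed
    moreover have "vs ! j = p (vs ! k)" using parent[OF j(1)] vs(3)[OF j(1)] j(2) by simp
    moreover have "vs ! l = p (vs ! k)" using parent[OF l] vs(3)[OF k(1)] by (simp add: l_def insert_commute)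
    ultimately show False using vs(2) j(1) l by (metis nth_eq_iff_index_eq)
  qed
  ultimately show ?thesis by (simp add: spanning_tree_def T_def)
qed

lemma finite_complete_edges: "finite (complete_edges n)"
  by (rule finite_subset[of _ "Pow {..<n}"]) (auto simp: complete_edges_def)

lemma spanning_tree_subset: "spanning_tree n T \<Longrightarrow> T \<subseteq> complete_edges n"
  by (simp add: spanning_tree_def)

lemma finite_spanning_tree: "spanning_tree n T \<Longrightarrow> finite T"
  by (rule finite_subset[OF spanning_tree_subset finite_complete_edges])

lemma finite_spanning_trees: "finite {T. spanning_tree n T}"
  by (rule finite_subset[of _ "Pow (complete_edges n)"])
    (auto simp: spanning_tree_def finite_complete_edges)

lemma lookup_char_vec:
  assumes "finite T"
  shows "Poly_Mapping.lookup (char_vec T) e = (if e \<in> T then 1 else 0)"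
  unfolding char_vec_def lookup_sum using assms by (simp add: lookup_single when_def)

lemma char_vec_inject:
  assumes "finite S" "finite T" "char_vec S = char_vec T"
  shows "S = T"
proof -
  have "e \<in> S \<longleftrightarrow> e \<in> T" for e
    using lookup_char_vec[OF assms(1), of e] lookup_char_vec[OF assms(2), of e] assms(3)
    by (auto split: if_splits)
  then show ?thesis by blast
qed

lemma polytope_spt: "polytope (spt_polytope n)"
  unfolding spt_polytope_def by (intro polytope_convex_hull finite_imageI finite_spanning_trees)

lemma linear_lookup: "linear (\<lambda>x :: 'k \<Rightarrow>\<^sub>0 real. Poly_Mapping.lookup x e)"
  by (rule linearI) (simp_all add: lookup_add lookup_scaleR)

text \<open>The face whose vertices are the spanning trees \<open>T\<close> with \<open>I \<subseteq> T \<subseteq> J\<close>.\<close>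

definition edge_interval :: "nat \<Rightarrow> nat set set \<Rightarrow> nat set set \<Rightarrow> (nat set \<Rightarrow>\<^sub>0 real) set" where
  "edge_interval n I J = {x \<in> spt_polytope n.
     (\<forall>e\<in>I. Poly_Mapping.lookup x e = 1) \<and> (\<forall>e\<in>complete_edges n - J. Poly_Mapping.lookup x e = 0)}"

text \<open>All coordinates lie between \<open>0\<close> and \<open>1\<close>, so the sum over \<open>I\<close> minus the sum outside \<open>J\<close> is at most
  \<open>card I\<close>, with equality exactly on the interval.\<close>

lemma exposed_in_edge_interval:
  assumes "finite I"
  shows "exposed_in (edge_interval n I J) (spt_polytope n)"
proof -
  let ?x = "Poly_Mapping.lookup :: (nat set \<Rightarrow>\<^sub>0 real) \<Rightarrow> nat set \<Rightarrow> real" and ?C = "complete_edges n - J"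
  have finC: "finite ?C" by (simp add: finite_complete_edges)
  have upper: "?x x e \<le> 1" if "x \<in> spt_polytope n" for x e
    using that unfolding spt_polytope_def
    by (rule linear_le_on_convex_hull[OF linear_lookup, rotated])
      (auto simp: lookup_char_vec finite_spanning_tree)
  have lower: "?x x e \<ge> 0" if "x \<in> spt_polytope n" for x e
  proof -
    have "- ?x x e \<le> 0"
      using that unfolding spt_polytope_def
      by (rule linear_le_on_convex_hull[OF linear_compose_neg[OF linear_lookup], rotated])
        (auto simp: lookup_char_vec finite_spanning_tree)
    then show ?thesis by simp
  qed
  let ?l = "\<lambda>x. (\<Sum>e\<in>I. ?x x e) - (\<Sum>e\<in>?C. ?x x e)"
  have slack: "real (card I) - ?l x = (\<Sum>e\<in>I. 1 - ?x x e) + (\<Sum>e\<in>?C. ?x x e)" for x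
    by (simp add: sum_subtractf)
  show ?thesis
  proof (rule exposed_inI)
    show "linear ?l"
      by (intro linear_compose_sub linear_compose_sum ballI linear_lookup)
    show "?l x \<le> real (card I)" if "x \<in> spt_polytope n" for x
    proof -
      have "(\<Sum>e\<in>I. 1 - ?x x e) \<ge> 0" "(\<Sum>e\<in>?C. ?x x e) \<ge> 0"
        using upper[OF that] lower[OF that] by (auto intro!: sum_nonneg)
      with slack[of x] show ?thesis by linarith
    qed
    show "edge_interval n I J = {x \<in> spt_polytope n. ?l x = real (card I)}"
      unfolding edge_interval_def
    proof (intro Collect_cong conj_cong refl)
      fix x assume x: "x \<in> spt_polytope n"
      have nn: "(\<Sum>e\<in>I. 1 - ?x x e) \<ge> 0" "(\<Sum>e\<in>?C. ?x x e) \<ge> 0"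
        using upper[OF x] lower[OF x] by (auto intro!: sum_nonneg)
      have "?l x = real (card I) \<longleftrightarrow> (\<Sum>e\<in>I. 1 - ?x x e) = 0 \<and> (\<Sum>e\<in>?C. ?x x e) = 0"
        using slack[of x] nn by linarith
      also have "\<dots> \<longleftrightarrow> (\<forall>e\<in>I. 1 - ?x x e = 0) \<and> (\<forall>e\<in>?C. ?x x e = 0)"
        using upper[OF x] lower[OF x] assms finC
        by (subst (1 2) sum_nonneg_eq_0_iff) auto
      finally show "((\<forall>e\<in>I. ?x x e = 1) \<and> (\<forall>e\<in>?C. ?x x e = 0)) = (?l x = real (card I))" by auto
    qed
  qed
qed

lemma edge_interval_singleton:
  assumes v: "spanning_tree n v" and I: "finite I" "I \<subseteq> v" "v \<subseteq> J"
    and unique: "\<And>T. spanning_tree n T \<Longrightarrow> I \<subseteq> T \<Longrightarrow> T \<subseteq> J \<Longrightarrow> T = v"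
  shows "edge_interval n I J = {char_vec v}"
proof -
  let ?X = "char_vec ` {T. spanning_tree n T}"
  have "edge_interval n I J face_of convex hull ?X"
    using exposed_in_edge_interval[OF I(1)]
    unfolding spt_polytope_def by (intro exposed_in_face_of convex_convex_hull)
  then have hull: "edge_interval n I J = convex hull (edge_interval n I J \<inter> ?X)"
    by (intro face_of_convex_hull_finite finite_imageI finite_spanning_trees)
  have "char_vec T \<in> edge_interval n I J \<longleftrightarrow> I \<subseteq> T \<and> T \<subseteq> J" if T: "spanning_tree n T" for T
  proof -
    have "char_vec T \<in> spt_polytope n"
      unfolding spt_polytope_def using T by (intro hull_inc imageI) simp
    then show ?thesis
      using I(2) spanning_tree_subset[OF T]
      by (auto simp: edge_interval_def lookup_char_vec[OF finite_spanning_tree[OF T]])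
  qed
  then have "edge_interval n I J \<inter> ?X = char_vec ` {T. spanning_tree n T \<and> I \<subseteq> T \<and> T \<subseteq> J}"
    by force
  also have "{T. spanning_tree n T \<and> I \<subseteq> T \<and> T \<subseteq> J} = {v}"
  proof (intro set_eqI iffI)
    show "T \<in> {v}" if "T \<in> {T. spanning_tree n T \<and> I \<subseteq> T \<and> T \<subseteq> J}" for T
      using that unique[of T] by simp
  qed (use v I(2,3) in simp)
  finally have "edge_interval n I J \<inter> ?X = {char_vec v}" by simp
  with hull show ?thesis by simp
qed

lemma edge_interval_Int:
  "edge_interval n I J \<inter> edge_interval n I' J' = edge_interval n (I \<union> I') (J \<inter> J')"
  by (auto simp: edge_interval_def)

text \<open>The intervals spanned by \<open>u\<close> and \<open>v\<close> and by \<open>w\<close> and \<open>v\<close> meet in the interval from \<open>v \<inter> (u \<union> w)\<close> to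
  \<open>v \<union> (u \<inter> w)\<close>, which the assumption shrinks to the vertex \<open>v\<close>.\<close>

lemma face_closed_between:
  assumes W: "face_closed (spt_polytope n) W"
    and trees: "spanning_tree n u" "spanning_tree n v" "spanning_tree n w"
    and uW: "char_vec u \<in> W" and wW: "char_vec w \<in> W"
    and unique: "\<And>T. spanning_tree n T \<Longrightarrow> v \<inter> (u \<union> w) \<subseteq> T \<Longrightarrow> T \<subseteq> v \<union> (u \<inter> w) \<Longrightarrow> T = v"
  shows "char_vec v \<in> W"
proof -
  have fin: "finite v" by (rule finite_spanning_tree[OF trees(2)])
  have tree_face: "char_vec T \<in> edge_interval n (T \<inter> v) (T \<union> v)" if T: "spanning_tree n T" for T
  proof -
    have "char_vec T \<in> spt_polytope n"
      unfolding spt_polytope_def using T by (intro hull_inc imageI) simp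
    then show ?thesis
      by (auto simp: edge_interval_def lookup_char_vec[OF finite_spanning_tree[OF T]])
  qed
  have "edge_interval n (u \<inter> v) (u \<union> v) \<inter> edge_interval n (w \<inter> v) (w \<union> v) = {char_vec v}"
    unfolding edge_interval_Int
  proof (rule edge_interval_singleton[OF trees(2)])
    show "T = v" if "spanning_tree n T" "u \<inter> v \<union> w \<inter> v \<subseteq> T" "T \<subseteq> (u \<union> v) \<inter> (w \<union> v)" for T
      by (rule unique[OF that(1)]) (use that(2,3) in blast)+
  qed (use fin in auto)
  moreover have "exposed_in (edge_interval n (T \<inter> v) (T \<union> v)) (spt_polytope n)" for T
    using fin by (intro exposed_in_edge_interval) auto
  moreover have "edge_interval n (u \<inter> v) (u \<union> v) \<inter> W \<noteq> {}"
    using tree_face[OF trees(1)] uW by auto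
  moreover have "edge_interval n (w \<inter> v) (w \<union> v) \<inter> W \<noteq> {}"
    using tree_face[OF trees(3)] wW by auto
  ultimately show ?thesis
    using W unfolding face_closed_def by metis
qed

section \<open>Double stars\<close>

text \<open>The vertices \<open>0\<close> and \<open>1\<close> are the hubs; \<open>S\<close> is the set of leaves attached to \<open>1\<close>.  The two stars are
  joined into a tree either by the edge between the hubs or by a path through the leaf \<open>i\<close>.\<close>

definition hub :: "nat set \<Rightarrow> nat \<Rightarrow> nat" where
  "hub S j = (if j \<in> S then 1 else 0)"

definition hub_stars :: "nat \<Rightarrow> nat set \<Rightarrow> nat set set" where
  "hub_stars n S = (\<lambda>j. {j, hub S j}) ` {2..<n}"

definition double_star :: "nat \<Rightarrow> nat set \<Rightarrow> nat set set" where
  "double_star n S = insert {0, 1} (hub_stars n S)"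

definition bridged_stars :: "nat \<Rightarrow> nat set \<Rightarrow> nat \<Rightarrow> nat set set" where
  "bridged_stars n S i = {{i, 0}, {i, 1}} \<union> hub_stars n S"

lemma double_star_spanning_tree:
  assumes "2 \<le> n"
  shows "spanning_tree n (double_star n S)"
proof -
  let ?p = "\<lambda>v. if v = 1 then 0 else hub S v"
  have "{..<n} - {0} = insert 1 {2..<n}" using assms by auto
  then have "(\<lambda>v. {v, ?p v}) ` ({..<n} - {0}) = double_star n S"
    by (auto simp: double_star_def hub_stars_def insert_commute)
  moreover have "spanning_tree n ((\<lambda>v. {v, ?p v}) ` ({..<n} - {0}))"
    by (rule parent_map_spanning_tree[where rk = "\<lambda>v. if v = 0 then 0 else if v = 1 then 1 else 2"])
      (use assms in \<open>auto simp: hub_def\<close>)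
  ultimately show ?thesis by simp
qed

lemma bridged_stars_spanning_tree:
  assumes "i \<in> {2..<n}"
  shows "spanning_tree n (bridged_stars n S i)"
proof -
  let ?p = "\<lambda>v. if v < 2 then i else hub S v"
  have "{..<n} - {i} = {0, 1} \<union> ({2..<n} - {i})" using assms by auto
  then have "(\<lambda>v. {v, ?p v}) ` ({..<n} - {i})
      = (\<lambda>v. {v, ?p v}) ` {0, 1} \<union> (\<lambda>v. {v, ?p v}) ` ({2..<n} - {i})"
    by (simp only: image_Un)
  also have "(\<lambda>v. {v, ?p v}) ` {0, 1} = {{i, 0}, {i, 1}}" by (simp add: insert_commute)
  also have "(\<lambda>v. {v, ?p v}) ` ({2..<n} - {i}) = (\<lambda>j. {j, hub S j}) ` ({2..<n} - {i})"
    by (intro image_cong) auto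
  also have "{{i, 0}, {i, 1}} \<union> \<dots> = {{i, 0}, {i, 1}} \<union> insert {i, hub S i} \<dots>"
    by (simp add: hub_def insert_absorb)
  also have "insert {i, hub S i} ((\<lambda>j. {j, hub S j}) ` ({2..<n} - {i})) = hub_stars n S"
    unfolding hub_stars_def using assms by (subst image_insert[symmetric]) (simp add: insert_absorb)
  also have "{{i, 0}, {i, 1}} \<union> hub_stars n S = bridged_stars n S i"
    by (simp add: bridged_stars_def)
  finally have "(\<lambda>v. {v, ?p v}) ` ({..<n} - {i}) = bridged_stars n S i" .
  moreover have "spanning_tree n ((\<lambda>v. {v, ?p v}) ` ({..<n} - {i}))"
    by (rule parent_map_spanning_tree[where rk = "\<lambda>v. if v = i then 0 else if v < 2 then 1 else 2"])
      (use assms in \<open>auto simp: hub_def\<close>)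
  ultimately show ?thesis by simp
qed

lemma hub_edge_not_in_hub_stars:
  "{0, 1} \<notin> hub_stars n S"
proof
  assume "{0, 1} \<in> hub_stars n S"
  then obtain j where j: "{0, 1} = {j, hub S j}" "j \<in> {2..<n}"
    unfolding hub_stars_def by (rule imageE)
  have "j \<in> {0, 1}" unfolding j(1) by (rule insertI1)
  with j(2) show False by simp
qed

lemma hub_edge_not_in_bridged_stars:
  assumes "i \<in> {2..<n}"
  shows "{0, 1} \<notin> bridged_stars n S i"
proof -
  have "i \<notin> {0, 1}" using assms by simp
  then have "{0, 1} \<noteq> {i, 0}" "{0, 1} \<noteq> {i, 1}" by (metis insertI1)+
  then show ?thesis using hub_edge_not_in_hub_stars by (simp add: bridged_stars_def)
qed

text \<open>No edge leaves the star of the hub \<open>0\<close>.\<close>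

lemma hub_stars_disconnected:
  assumes "2 \<le> n"
  shows "\<not> graph_connected {..<n} (hub_stars n S)"
proof
  assume "graph_connected {..<n} (hub_stars n S)"
  then have "(0, 1) \<in> {(a, b). {a, b} \<in> hub_stars n S}\<^sup>*"
    using assms by (simp add: graph_connected_def)
  then have "1 \<in> insert 0 ({2..<n} - S)"
  proof (induction rule: rtrancl_induct)
    case (step a b)
    then have "{a, b} \<in> hub_stars n S" by simp
    then obtain j where j: "{a, b} = {j, hub S j}" "j \<in> {2..<n}"
      unfolding hub_stars_def by (rule imageE)
    then have "a = j \<and> b = hub S j \<or> a = hub S j \<and> b = j" by (simp add: doubleton_eq_iff)
    then show ?case using step.IH j(2) by (auto simp: hub_def split: if_splits)
  qed simp
  then show False by simp
qed

text \<open>If \<open>S\<close> and \<open>S'\<close> differ at \<open>i\<close>, the two double stars together contain both edges from \<open>i\<close> to the hubs.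
  So the tree bridged at \<open>i\<close> lies in their union, and the only edge that could be added to it, \<open>{0, 1}\<close>,
  closes a triangle.  From there the bridge moves to the leaf \<open>2\<close>: the tree bridged at \<open>2\<close> contains what the
  double star and the tree bridged at \<open>i\<close> have in common, the two disconnected stars, and it has only
  one further edge.  The bridge at \<open>2\<close> depends on \<open>S\<close> alone, as the lower bound requires.\<close>

lemma bridged_stars_in_face_closed:
  assumes W: "face_closed (spt_polytope n) W" and n: "3 \<le> n"
    and S: "S \<subseteq> {2..<n}" "S' \<subseteq> {2..<n}" "S \<noteq> S'"
    and SW: "char_vec (double_star n S) \<in> W" and S'W: "char_vec (double_star n S') \<in> W"
  shows "char_vec (bridged_stars n S 2) \<in> W"
proof -
  have n2: "2 \<le> n" "2 \<in> {2..<n}" using n by auto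
  note D = double_star_spanning_tree[OF n2(1)]
  \<comment> \<open>set reasoning should treat this edge as an atom\<close>
  define e :: "nat set" where "e = {0, 1}"
  have star: "double_star n S = insert e (hub_stars n S)" for S
    by (simp add: double_star_def e_def)
  have stars_sub: "hub_stars n S \<subseteq> bridged_stars n S j" for S j
    unfolding bridged_stars_def by (rule Un_upper2)
  obtain i where i: "i \<in> {2..<n}" "i \<in> S \<longleftrightarrow> i \<notin> S'" using S by blast
  define a b where "a = {i, hub S i}" and "b = {i, hub S' i}"
  have ab: "a \<in> hub_stars n S" "b \<in> hub_stars n S'"
    using i(1) unfolding hub_stars_def a_def b_def by (rule imageI)+
  have ends: "{{i, 0}, {i, 1}} = {a, b}"
    unfolding a_def b_def using i(2) by (cases "i \<in> S") (simp_all add: hub_def insert_commute)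
  have bridge: "bridged_stars n S i = {a, b} \<union> hub_stars n S"
    unfolding bridged_stars_def ends ..
  have covered: "bridged_stars n S i \<subseteq> double_star n S \<union> double_star n S'"
    unfolding star bridge using ab by blast
  have e_notin: "e \<notin> bridged_stars n S i"
    unfolding e_def by (rule hub_edge_not_in_bridged_stars[OF i(1)])
  have RW: "char_vec (bridged_stars n S i) \<in> W"
  proof (rule face_closed_between[OF W D bridged_stars_spanning_tree[OF i(1)] D SW S'W])
    fix T assume T: "spanning_tree n T"
      "bridged_stars n S i \<inter> (double_star n S \<union> double_star n S') \<subseteq> T"
      "T \<subseteq> bridged_stars n S i \<union> (double_star n S \<inter> double_star n S')"
    have sub: "bridged_stars n S i \<subseteq> T" using T(2) covered by blast
    have "e \<notin> T"
    proof
      assume "e \<in> T"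
      then have "{0, 1} \<in> T" by (simp add: e_def)
      moreover have "{{i, 0}, {i, 1}} \<subseteq> T" using sub unfolding bridge ends by blast
      then have "{1, i} \<in> T" "{i, 0} \<in> T" by (simp_all add: insert_commute)
      ultimately have "graph_cycle T [0, 1, i]"
        using i(1) by (simp add: graph_cycle_def All_less_Suc)
      with T(1) show False by (auto simp: spanning_tree_def)
    qed
    moreover have "T \<subseteq> insert e (bridged_stars n S i)"
      using T(3) stars_sub[of S i] unfolding star by blast
    ultimately show "T = bridged_stars n S i" using sub by blast
  qed
  show ?thesis
  proof (rule face_closed_between[OF W D bridged_stars_spanning_tree[OF n2(2)]
        bridged_stars_spanning_tree[OF i(1)] SW RW])
    fix T assume T: "spanning_tree n T"
      "bridged_stars n S 2 \<inter> (double_star n S \<union> bridged_stars n S i) \<subseteq> T"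
      "T \<subseteq> bridged_stars n S 2 \<union> (double_star n S \<inter> bridged_stars n S i)"
    have sub: "hub_stars n S \<subseteq> T" using T(2) stars_sub[of S] unfolding star by blast
    have T2: "T \<subseteq> bridged_stars n S 2" using T(3) stars_sub[of S 2] e_notin unfolding star by blast
    have "{2, hub S 2} \<in> hub_stars n S" using n2(2) unfolding hub_stars_def by (rule imageI)
    then obtain c where c: "bridged_stars n S 2 = insert c (hub_stars n S)"
      unfolding bridged_stars_def
      by (cases "2 \<in> S") (simp_all add: hub_def insert_absorb insert_commute)
    have "T \<noteq> hub_stars n S"
      using T(1) hub_stars_disconnected[OF n2(1), of S] by (auto simp: spanning_tree_def)
    then have "c \<in> T" using T2 sub unfolding c by blast
    with T2 sub show "T = bridged_stars n S 2" unfolding c by blast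
  qed
qed

lemma sxc_spt_polytope_ge:
  assumes n: "3 \<le> n"
  shows "2 ^ (n - 2) \<le> sxc (spt_polytope n)"
proof (rule sxc_lower_bound[OF polytope_spt])
  fix Q :: "(nat \<Rightarrow>\<^sub>0 real) set"
  assume Q: "simple_polytope Q" "is_extension Q (spt_polytope n)"
  let ?I = "Pow {2..<n}" and ?v = "\<lambda>S. char_vec (double_star n S)"
    and ?w = "\<lambda>S. char_vec (bridged_stars n S 2)"
  have n2: "2 \<le> n" "2 \<in> {2..<n}" using n by auto
  note D = double_star_spanning_tree[OF n2(1)] and R = bridged_stars_spanning_tree[OF n2(2)]
  have "card ?I \<le> num_facets Q"
  proof (rule simple_extension_lower_bound[OF Q])
    fix S assume "S \<in> ?I"
    show "?v S \<in> spt_polytope n"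
      unfolding spt_polytope_def using D[of S] by (intro hull_inc imageI) simp
    have finR: "finite (bridged_stars n S 2)" by (rule finite_spanning_tree[OF R])
    have "edge_interval n (bridged_stars n S 2) (bridged_stars n S 2) = {?w S}"
      by (rule edge_interval_singleton[OF R finR order_refl order_refl]) (rule subset_antisym)
    then show "exposed_in {?w S} (spt_polytope n)"
      using exposed_in_edge_interval[OF finR] by metis
    have "{0, 1} \<in> double_star n S" unfolding double_star_def by (rule insertI1)
    then have "bridged_stars n S 2 \<noteq> double_star n S"
      using hub_edge_not_in_bridged_stars[OF n2(2), of S] by metis
    then show "?w S \<noteq> ?v S"
      using char_vec_inject[OF finR finite_spanning_tree[OF D]] by metis
  next
    fix W S S'
    assume "face_closed (spt_polytope n) W" "S \<in> ?I" "S' \<in> ?I" "S \<noteq> S'" "?v S \<in> W" "?v S' \<in> W"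
    then show "?w S \<in> W" using bridged_stars_in_face_closed[of n W S S'] n by simp
  qed
  then show "2 ^ (n - 2) \<le> num_facets Q" by (simp add: card_Pow)
qed

theorem theorem5p2:
  shows "\<exists>(g :: nat \<Rightarrow> real) (c :: real) (n0 :: nat).
    (\<lambda>n. g n / real n) \<longlonglongrightarrow> 0 \<and> c > 0 \<and>
    (\<forall>n\<ge>n0. real (sxc (spt_polytope n)) \<ge> c * 2 powr (real n - g n))"
proof (intro exI conjI allI impI)
  show "(\<lambda>n. (\<lambda>_. 0) n / real n) \<longlonglongrightarrow> 0" by simp
  show "(1 / 4 :: real) > 0" by simp
  fix n :: nat assume n: "3 \<le> n"
  have "(1 / 4) * 2 powr (real n - 0) = (2 ^ n / 4 :: real)" by (simp add: powr_realpow)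
  also have "\<dots> = 2 ^ (n - 2)"
  proof -
    obtain m where "n = m + 2" using n le_Suc_ex[of 2 n] by auto
    then show ?thesis by simp
  qed
  also have "\<dots> = real (2 ^ (n - 2))" by simp
  also have "\<dots> \<le> real (sxc (spt_polytope n))"
    using sxc_spt_polytope_ge[OF n] by (simp only: of_nat_le_iff)
  finally show "(1 / 4) * 2 powr (real n - (\<lambda>_. 0) n) \<le> real (sxc (spt_polytope n))" .
qed

end
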